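(* Let $(R,\mathfrak m)$ be a Noetherian local ring, let $I$ be any $R$-ideal, let $M$ be a finitely generated $R$-module, and let $q$ be an ideal of definition on $M/IM$. For any $x\in I$ write $\overline{M}=M/xM$. Then for all non-negative integers $s$ and $t$ (empty sums being $0$): $$ \begin{aligned} H_{(q,I,M)}^{(1,0)}(s,t)=\;&H_{(q,I,\overline{M})}^{(1,1)}(s,t)\\ &+\sum_{\nu=2}^{t}\lambda\Big(\big(I^{\nu}M:_M x\big)\big/\big[\big((q^{s+1}I^{\nu}M+I^{\nu+1}M):_M x\big)+I^{\nu-1}M\big]\Big)\\ &-\sum_{\nu=1}^{t}\lambda\Big(\big[(q^{s+1}I^{\nu}M+I^{\nu+1}M):_{I^{\nu-1}M}x\big]\big/\big[q^{s+1}I^{\nu-1}M+I^{\nu}M\big]\Big). \end{aligned} $$ Moreover, if $I$ is an ideal of definition on $M$, then for $s\gg 0$ the formula expressing $H_{(q,I,M)}^{(1,0)}(s,t)$ as $H_{(q,I,\overline{M})}^{(1,1)}(s,t)$ plus the sum over $2\le\nu\le t$ minus the sum over $1\le\nu\le t$ becomes the usual Singh's formula $$ \lambda(I^{t}M/I^{t+1}M)=\lambda\big(M/(I^{t+1}M+xM)\big)-\lambda\big((I^{t+1}M:_M x)/I^{t}M\big) $$ for every $t\ge 0$.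
   Context: $\lambda$ denotes length. An ideal $q\subseteq\mathfrak m$ is an ideal of definition on a finite $R$-module $N$ if $N/qN$ has finite length. For submodules $N_1,N_2\subseteq M$ and $x\in R$, $N_1:_{N_2}x=\{a\in N_2 : xa\in N_1\}$. For a finite $R$-module $N$ with $q$ an ideal of definition on $N/IN$ (this applies both to $N=M$ and to $N=\overline M$), put, for $s,t\ge 0$, $$H_{(q,I,N)}^{(1,0)}(s,t)=\lambda\big(I^tN/(q^{s+1}I^tN+I^{t+1}N)\big),\qquad H_{(q,I,N)}^{(1,1)}(s,t)=\sum_{\nu=0}^{t}H_{(q,I,N)}^{(1,0)}(s,\nu).$$ *)

theory Defs
  imports "HOL-Library.Extended_Nat" "HOL-Algebra.Algebra"
begin

locale noetherian_local_ring = cring R + noetherian_ring R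
  for R (structure) and \<mm> +
  assumes maximal: "maximalideal \<mm> R"
    and unique_maximal: "maximalideal J R \<Longrightarrow> J = \<mm>"

definition submodule_span ::
    "('a, 'r) ring_scheme \<Rightarrow> ('a, 'b, 'm) module_scheme \<Rightarrow> 'b set \<Rightarrow> 'b set" where
  "submodule_span R M S = \<Inter> {N. submodule N R M \<and> S \<subseteq> N}"

definition finitely_generated_module ::
    "('a, 'r) ring_scheme \<Rightarrow> ('a, 'b, 'm) module_scheme \<Rightarrow> bool" where
  "finitely_generated_module R M \<longleftrightarrow>
     module R M \<and> (\<exists>S. finite S \<and> S \<subseteq> carrier M \<and> submodule_span R M S = carrier M)"

text \<open>The quotient module \<open>M / N\<close>, on cosets. A \<^const>\<open>module\<close> record inherits the fields
  \<open>mult\<close> and \<open>one\<close> from rings; they play no role for modules and are left unspecified.\<close>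

definition quotient_module ::
    "('a, 'b, 'm) module_scheme \<Rightarrow> 'b set \<Rightarrow> ('a, 'b set) module" where
  "quotient_module M N =
     \<lparr>carrier = a_rcosets\<^bsub>M\<^esub> N, monoid.mult = undefined, monoid.one = undefined,
      ring.zero = N, ring.add = set_add M,
      smult = (\<lambda>a Y. \<Union>y\<in>Y. N +>\<^bsub>M\<^esub> (a \<odot>\<^bsub>M\<^esub> y))\<rparr>"

text \<open>Length of a module: the supremum of the lengths \<open>n\<close> of strictly increasing chains
  \<open>C 0 \<subset> \<dots> \<subset> C n\<close> of submodules.\<close>

definition module_length ::
    "('a, 'r) ring_scheme \<Rightarrow> ('a, 'b, 'm) module_scheme \<Rightarrow> enat" where
  "module_length R M =
     Sup {enat n |n. \<exists>C :: nat \<Rightarrow> 'b set.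
       (\<forall>i\<le>n. submodule (C i) R M) \<and> (\<forall>i<n. C i \<subset> C (Suc i))}"

text \<open>\<open>\<lambda>(A/B)\<close> for submodules \<open>B \<subseteq> A\<close> of \<open>M\<close>.\<close>

definition quot_length ::
    "('a, 'r) ring_scheme \<Rightarrow> ('a, 'b, 'm) module_scheme \<Rightarrow> 'b set \<Rightarrow> 'b set \<Rightarrow> enat" where
  "quot_length R M A B = module_length R (quotient_module (M\<lparr>carrier := A\<rparr>) B)"

definition ideal_smult ::
    "('a, 'r) ring_scheme \<Rightarrow> ('a, 'b, 'm) module_scheme \<Rightarrow> 'a set \<Rightarrow> 'b set \<Rightarrow> 'b set" where
  "ideal_smult R M J N = submodule_span R M {a \<odot>\<^bsub>M\<^esub> y |a y. a \<in> J \<and> y \<in> N}"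

text \<open>\<open>J\<^sup>n N\<close>; powers are taken in the multiplicative monoid of ideals, so \<open>J\<^sup>0 = R\<close>.\<close>

definition ideal_pow_smult ::
    "('a, 'r) ring_scheme \<Rightarrow> ('a, 'b, 'm) module_scheme \<Rightarrow> 'a set \<Rightarrow> nat \<Rightarrow> 'b set \<Rightarrow> 'b set" where
  "ideal_pow_smult R M J n N = ideal_smult R M (J [^]\<^bsub>ideals_set R\<^esub> n) N"

definition elt_smult :: "('a, 'b, 'm) module_scheme \<Rightarrow> 'a \<Rightarrow> 'b set" where
  "elt_smult M x = (\<lambda>y. x \<odot>\<^bsub>M\<^esub> y) ` carrier M"

text \<open>\<open>N\<^sub>1 :\<^bsub>N\<^sub>2\<^esub> x\<close>\<close>

definition colon :: "('a, 'b, 'm) module_scheme \<Rightarrow> 'b set \<Rightarrow> 'b set \<Rightarrow> 'a \<Rightarrow> 'b set" where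
  "colon M N\<^sub>1 N\<^sub>2 x = {y \<in> N\<^sub>2. x \<odot>\<^bsub>M\<^esub> y \<in> N\<^sub>1}"

definition ideal_of_definition ::
    "('a, 'r) ring_scheme \<Rightarrow> 'a set \<Rightarrow> 'a set \<Rightarrow> ('a, 'b, 'm) module_scheme \<Rightarrow> bool" where
  "ideal_of_definition R \<mm> q N \<longleftrightarrow>
     ideal q R \<and> q \<subseteq> \<mm> \<and>
     module_length R (quotient_module N (ideal_smult R N q (carrier N))) \<noteq> \<infinity>"

text \<open>\<open>q\<^bsup>s+1\<^esup> I\<^sup>t N + I\<^bsup>t+1\<^esup> N\<close>\<close>

definition hilbert_denom ::
    "('a, 'r) ring_scheme \<Rightarrow> 'a set \<Rightarrow> 'a set \<Rightarrow> ('a, 'b, 'm) module_scheme \<Rightarrow>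
     nat \<Rightarrow> nat \<Rightarrow> 'b set" where
  "hilbert_denom R q I N s t =
     ideal_pow_smult R N q (s + 1) (ideal_pow_smult R N I t (carrier N))
       <+>\<^bsub>N\<^esub> ideal_pow_smult R N I (t + 1) (carrier N)"

definition H10 ::
    "('a, 'r) ring_scheme \<Rightarrow> 'a set \<Rightarrow> 'a set \<Rightarrow> ('a, 'b, 'm) module_scheme \<Rightarrow>
     nat \<Rightarrow> nat \<Rightarrow> enat" where
  "H10 R q I N s t =
     quot_length R N (ideal_pow_smult R N I t (carrier N)) (hilbert_denom R q I N s t)"

definition H11 ::
    "('a, 'r) ring_scheme \<Rightarrow> 'a set \<Rightarrow> 'a set \<Rightarrow> ('a, 'b, 'm) module_scheme \<Rightarrow>
     nat \<Rightarrow> nat \<Rightarrow> enat" where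
  "H11 R q I N s t = (\<Sum>\<nu>=0..t. H10 R q I N s \<nu>)"

text \<open>The summands of the two correction sums in the generalized Singh formula; they are only
  used for \<open>\<nu> \<ge> 2\<close> and \<open>\<nu> \<ge> 1\<close> respectively, where \<open>\<nu> - 1\<close> is not truncated.\<close>

definition singh_plus ::
    "('a, 'r) ring_scheme \<Rightarrow> 'a set \<Rightarrow> 'a set \<Rightarrow> ('a, 'b, 'm) module_scheme \<Rightarrow>
     'a \<Rightarrow> nat \<Rightarrow> nat \<Rightarrow> enat" where
  "singh_plus R q I M x s \<nu> =
     quot_length R M
       (colon M (ideal_pow_smult R M I \<nu> (carrier M)) (carrier M) x)
       (colon M (hilbert_denom R q I M s \<nu>) (carrier M) x
          <+>\<^bsub>M\<^esub> ideal_pow_smult R M I (\<nu> - 1) (carrier M))"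

definition singh_minus ::
    "('a, 'r) ring_scheme \<Rightarrow> 'a set \<Rightarrow> 'a set \<Rightarrow> ('a, 'b, 'm) module_scheme \<Rightarrow>
     'a \<Rightarrow> nat \<Rightarrow> nat \<Rightarrow> enat" where
  "singh_minus R q I M x s \<nu> =
     quot_length R M
       (colon M (hilbert_denom R q I M s \<nu>) (ideal_pow_smult R M I (\<nu> - 1) (carrier M)) x)
       (hilbert_denom R q I M s (\<nu> - 1))"

text \<open>Finite lengths as integers, so that they can be subtracted. The value at \<open>\<infinity>\<close> is
  meaningless; finiteness has to be stated alongside.\<close>

abbreviation enat_int :: "enat \<Rightarrow> int" where
  "enat_int k \<equiv> int (the_enat k)"

end

theory Submission
  imports Defs
begin

text \<open>Put \<open>F\<^sub>t = I\<^sup>tM\<close> and \<open>D\<^sub>t = q\<^bsup>s+1\<^esup>F\<^sub>t + F\<^bsub>t+1\<^esub>\<close>. Comparing \<open>F\<^sub>t/D\<^sub>t\<close> with its image modulo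
  \<open>xM\<close>, the kernel is identified by multiplication by \<open>x\<close> with \<open>(F\<^sub>t : x)/(D\<^sub>t : x)\<close>. Inserting
  \<open>(D\<^sub>t : x) + F\<^bsub>t-1\<^esub>\<close> splits off the summand of the first correction sum, and the rest is
  \<open>F\<^bsub>t-1\<^esub>/((D\<^sub>t : x) \<inter> F\<^bsub>t-1\<^esub>)\<close>, that is \<open>F\<^bsub>t-1\<^esub>/D\<^bsub>t-1\<^esub>\<close> minus the summand of the second one.
  The resulting recursion in \<open>t\<close> telescopes. Since \<open>I\<close> and \<open>q\<close> are finitely generated, finiteness of
  \<open>M/(q + I)M\<close> carries over to all \<open>F\<^sub>t/D\<^sub>t\<close>. If \<open>M/IM\<close> has finite length, Nakayama's lemma gives
  \<open>q\<^bsup>s+1\<^esup>M \<subseteq> IM\<close> for large \<open>s\<close>, hence \<open>D\<^sub>t = F\<^bsub>t+1\<^esub>\<close> for all \<open>t\<close> at once.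

  All lengths are computed as suprema of chains of submodules of \<open>M\<close> itself, between two given
  submodules.\<close>

text \<open>Each quotient construction changes the element type: M/IM lives on sets, its quotient by
  q on sets of sets, and \<open>quot_length\<close> restricts a carrier first. Inside M there is one
  modular lattice of submodules in which all pieces can be compared, added and cancelled. The tools
  there are additivity of length and the fact that a map of submodules which preserves and reflects
  inclusion of nested pairs does not lower length. Cancellation is the other obstacle, as the
  formula subtracts. Each additive identity is therefore proved in \<open>enat\<close>, infinite
  values included, and passes to integers only once finiteness is known. Finiteness rests on D_t =
  I^t (q^(s+1) M + IM): a finitely generated ideal K turns an interval of finite length from P to A
  into one from KP to KA, which is used with powers of q and then with I^t. The sum over \<nu> \<ge>
  2 has one term fewer than the recursion produces: the term at \<nu> = 1 is zero because F_0 = M.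
  The recursion starts without a correction because xM \<subseteq> IM \<subseteq> D_0.\<close>

section \<open>Extended natural numbers\<close>

lemma enat_leI: "(\<And>n. enat n \<le> a \<Longrightarrow> enat n \<le> b) \<Longrightarrow> a \<le> (b::enat)"
proof (rule ccontr)
  assume *: "\<And>n. enat n \<le> a \<Longrightarrow> enat n \<le> b" and "\<not> a \<le> b"
  then have "b < a" by simp
  moreover from this obtain k where "b = enat k" by (cases b) auto
  ultimately show False using *[of "Suc k"] by (simp add: Suc_ile_eq)
qed

text \<open>Superadditivity of length has to cover infinite summands too; it is enough to combine
  finite chains of arbitrary length on either side.\<close>

lemma enat_add_leI:
  fixes a b c :: enat
  assumes "\<And>n m. enat n \<le> a \<Longrightarrow> enat m \<le> b \<Longrightarrow> enat (n + m) \<le> c"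
  shows "a + b \<le> c"
proof (rule enat_leI)
  fix k assume k: "enat k \<le> a + b"
  show "enat k \<le> c"
  proof (cases a)
    case (enat n)
    show ?thesis
    proof (cases b)
      case b: (enat m)
      show ?thesis using k assms[of n m] enat b by (metis order_trans plus_enat_simps(1) order_refl)
    next
      case infinity
      \<comment> \<open>An infinite summand alone bounds \<open>c\<close> from below by every
        natural number, with 0 taken from the other side.\<close>
      then show ?thesis using assms[of 0 k] k by (simp add: zero_enat_def[symmetric])
    qed
  next
    case infinity
    then show ?thesis using assms[of k 0] by (simp add: zero_enat_def[symmetric])
  qed
qed

lemma enat_le_finite: "a \<le> b \<Longrightarrow> b \<noteq> \<infinity> \<Longrightarrow> a \<noteq> (\<infinity> :: enat)"
  by (cases a; cases b) auto

lemma enat_add_finite_iff: "a + b \<noteq> \<infinity> \<longleftrightarrow> a \<noteq> \<infinity> \<and> b \<noteq> (\<infinity> :: enat)"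
  by (cases a; cases b) auto

lemma enat_int_add: "a \<noteq> \<infinity> \<Longrightarrow> b \<noteq> \<infinity> \<Longrightarrow> enat_int (a + b) = enat_int a + enat_int b"
  by (cases a; cases b) auto

lemma enat_int_sum:
  assumes "finite A" "\<And>i. i \<in> A \<Longrightarrow> f i \<noteq> \<infinity>"
  shows "sum f A \<noteq> \<infinity> \<and> enat_int (sum f A) = (\<Sum>i\<in>A. enat_int (f i))"
  using assms
proof (induction A rule: finite_induct)
  case (insert a A)
  then have "f a \<noteq> \<infinity>" "sum f A \<noteq> \<infinity>" "enat_int (sum f A) = (\<Sum>i\<in>A. enat_int (f i))" by blast+
  moreover have "sum f (insert a A) = f a + sum f A" using insert.hyps by simp
  ultimately show ?case
    using insert.hyps by (simp only: enat_add_finite_iff enat_int_add sum.insert simp_thms)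
qed (simp add: zero_enat_def)

subsection \<open>Chains of submodules\<close>

text \<open>Chains may start above \<open>B\<close> and stop below \<open>A\<close>. This makes
  monotonicity in both ends immediate and gives a meaning to arbitrary sets \<open>B\<close> and
  \<open>A\<close>; an empty interval has length 0.\<close>

definition interval_length ::
    "('a, 'r) ring_scheme \<Rightarrow> ('a, 'b, 'm) module_scheme \<Rightarrow> 'b set \<Rightarrow> 'b set \<Rightarrow> enat" where
  "interval_length R M B A =
     Sup {enat n |n. \<exists>C :: nat \<Rightarrow> 'b set.
       (\<forall>i\<le>n. submodule (C i) R M \<and> B \<subseteq> C i \<and> C i \<subseteq> A) \<and> (\<forall>i<n. C i \<subset> C (Suc i))}"

lemma interval_length_geI:
  assumes "\<And>i. i \<le> n \<Longrightarrow> submodule (C i) R M \<and> B \<subseteq> C i \<and> C i \<subseteq> A"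
    and "\<And>i. i < n \<Longrightarrow> C i \<subset> C (Suc i)"
  shows "enat n \<le> interval_length R M B A"
  unfolding interval_length_def by (rule Sup_upper) (use assms in blast)

lemma interval_length_leI:
  assumes "\<And>n C. (\<And>i. i \<le> n \<Longrightarrow> submodule (C i) R M \<and> B \<subseteq> C i \<and> C i \<subseteq> A) \<Longrightarrow>
      (\<And>i. i < n \<Longrightarrow> C i \<subset> C (Suc i)) \<Longrightarrow> enat n \<le> k"
  shows "interval_length R M B A \<le> k"
  unfolding interval_length_def
proof (rule Sup_least, clarify)
  fix n C
  assume "\<forall>i\<le>n. submodule (C i) R M \<and> B \<subseteq> C i \<and> C i \<subseteq> A" "\<forall>i<n. C i \<subset> C (Suc i)"
  then show "enat n \<le> k" by (intro assms[of n C]) auto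
qed

text \<open>A strict chain is carried by \<open>g\<close> to a strict chain. Reflection is asked
  only for nested pairs, because only neighbours in a chain are compared; hence \<open>g\<close> can
  be intersection or sum with a fixed submodule.\<close>

lemma interval_length_map:
  assumes map: "\<And>V. submodule V R M \<Longrightarrow> B \<subseteq> V \<Longrightarrow> V \<subseteq> A \<Longrightarrow>
      submodule (g V) R' M' \<and> B' \<subseteq> g V \<and> g V \<subseteq> A'"
    and mono: "\<And>V W. submodule V R M \<Longrightarrow> submodule W R M \<Longrightarrow> B \<subseteq> V \<Longrightarrow> V \<subseteq> W \<Longrightarrow> W \<subseteq> A \<Longrightarrow>
      g V \<subseteq> g W"
    and reflect: "\<And>V W. submodule V R M \<Longrightarrow> submodule W R M \<Longrightarrow> B \<subseteq> V \<Longrightarrow> V \<subseteq> W \<Longrightarrow> W \<subseteq> A \<Longrightarrow>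
      g W \<subseteq> g V \<Longrightarrow> W \<subseteq> V"
  shows "interval_length R M B A \<le> interval_length R' M' B' A'"
proof (rule interval_length_leI)
  fix n C
  assume C: "\<And>i. i \<le> n \<Longrightarrow> submodule (C i) R M \<and> B \<subseteq> C i \<and> C i \<subseteq> A"
    and strict: "\<And>i. i < n \<Longrightarrow> C i \<subset> C (Suc i)"
  show "enat n \<le> interval_length R' M' B' A'"
  proof (rule interval_length_geI[where C = "\<lambda>i. g (C i)"])
    fix i assume "i \<le> n"
    then show "submodule (g (C i)) R' M' \<and> B' \<subseteq> g (C i) \<and> g (C i) \<subseteq> A'"
      using C map by blast
  next
    fix i assume i: "i < n"
    have *: "submodule (C i) R M" "submodule (C (Suc i)) R M" "B \<subseteq> C i" "C i \<subseteq> C (Suc i)"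
        "C (Suc i) \<subseteq> A" "\<not> C (Suc i) \<subseteq> C i"
      using C[of i] C[of "Suc i"] strict[OF i] i by auto
    show "g (C i) \<subset> g (C (Suc i))"
      using mono[OF *(1-5)] reflect[OF *(1-5)] *(6) by blast
  qed
qed

lemma interval_length_mono:
  assumes "B' \<subseteq> B" "A \<subseteq> A'"
  shows "interval_length R M B A \<le> interval_length R M B' A'"
  by (rule interval_length_map[where g = "\<lambda>V. V"]) (use assms in auto)

text \<open>An infinite supremum is not attained, but every finite value below it is, by truncating
  a longer chain. The assumptions on \<open>A\<close> supply the one-term chain for
  \<open>n = 0\<close>.\<close>

lemma enat_le_interval_length_D:
  assumes "enat n \<le> interval_length R M B A" and "submodule A R M" and "B \<subseteq> A"
  shows "\<exists>C. (\<forall>i\<le>n. submodule (C i) R M \<and> B \<subseteq> C i \<and> C i \<subseteq> A) \<and> (\<forall>i<n. C i \<subset> C (Suc i))"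
proof (cases "n = 0")
  case True
  show ?thesis by (intro exI[of _ "\<lambda>_. A"]) (use assms True in auto)
next
  case False
  \<comment> \<open>Being strictly below the supremum yields a chain of length k > n - 1, that is k
    \<ge> n, whose initial segment is taken.\<close>
  then have "enat (n - 1) < interval_length R M B A"
    using assms(1) by (metis diff_less enat_ord_simps(2) less_le_trans less_numeral_extra(1) neq0_conv)
  then obtain k C where "enat (n - 1) < enat k"
    and C: "\<forall>i\<le>k. submodule (C i) R M \<and> B \<subseteq> C i \<and> C i \<subseteq> A" "\<forall>i<k. C i \<subset> C (Suc i)"
    unfolding interval_length_def less_Sup_iff by blast
  then have "n \<le> k" by simp
  then show ?thesis by (intro exI[of _ C]) (use C in auto)
qed

lemma interval_length_superadd:
  assumes "submodule B R M" "submodule A R M" "Z \<subseteq> B" "B \<subseteq> A"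
  shows "interval_length R M Z B + interval_length R M B A \<le> interval_length R M Z A"
proof (rule enat_add_leI)
  fix n m
  assume n: "enat n \<le> interval_length R M Z B" and m: "enat m \<le> interval_length R M B A"
  obtain C where
    C: "\<And>i. i \<le> n \<Longrightarrow> submodule (C i) R M \<and> Z \<subseteq> C i \<and> C i \<subseteq> B" "\<And>i. i < n \<Longrightarrow> C i \<subset> C (Suc i)"
    using enat_le_interval_length_D[OF n assms(1,3)] by blast
  obtain D where
    D: "\<And>i. i \<le> m \<Longrightarrow> submodule (D i) R M \<and> B \<subseteq> D i \<and> D i \<subseteq> A" "\<And>i. i < m \<Longrightarrow> D i \<subset> D (Suc i)"
    using enat_le_interval_length_D[OF m assms(2,4)] by blast
  \<comment> \<open>The last term of \<open>C\<close> is dropped in favour of \<open>D 0\<close>: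
    both lie at the junction, with \<open>C n\<close> \<subseteq> \<open>B\<close> \<subseteq>
    \<open>D 0\<close>, and keeping both could repeat a term.\<close>
  let ?E = "\<lambda>i. if i < n then C i else D (i - n)"
  show "enat (n + m) \<le> interval_length R M Z A"
  proof (rule interval_length_geI[where C = ?E])
    fix i assume i: "i \<le> n + m"
    show "submodule (?E i) R M \<and> Z \<subseteq> ?E i \<and> ?E i \<subseteq> A"
    proof (cases "i < n")
      case True
      then show ?thesis using C(1)[of i] assms(4) by auto
    next
      case False
      then show ?thesis using i D(1)[of "i - n"] assms(3) by (auto simp: le_diff_conv)
    qed
  next
    fix i assume i: "i < n + m"
    consider "Suc i < n" | "Suc i = n" | "n \<le> i" by linarith
    then show "?E i \<subset> ?E (Suc i)"
    proof cases
      case 1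
      then show ?thesis using C(2)[of i] by simp
    next
      case 2
      then have "C i \<subset> C n" "C n \<subseteq> D 0" using C(1)[of n] C(2)[of i] D(1)[of 0] by auto
      then show ?thesis using 2 by auto
    next
      case 3
      then show ?thesis using i D(2)[of "i - n"] by (simp add: Suc_diff_le)
    qed
  qed
qed

lemma interval_length_pos:
  assumes "submodule B R M" "submodule A R M" "B \<subset> A"
  shows "1 \<le> interval_length R M B A"
proof -
  have "enat 1 \<le> interval_length R M B A"
    by (rule interval_length_geI[where C = "\<lambda>i. if i = 0 then B else A"]) (use assms in auto)
  then show ?thesis by (simp add: one_enat_def)
qed

lemma interval_length_eq_0_D:
  assumes "interval_length R M B A = 0" "submodule B R M" "submodule A R M" "B \<subseteq> A"
  shows "B = A"
  using interval_length_pos[of B R M A] assms by (auto simp: psubset_eq)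

lemma interval_length_self [simp]: "interval_length R M A A = 0"
proof -
  have "interval_length R M A A \<le> 0"
  proof (rule interval_length_leI)
    fix n C
    assume C: "\<And>i. i \<le> n \<Longrightarrow> submodule (C i) R M \<and> A \<subseteq> C i \<and> C i \<subseteq> A" "\<And>i. i < n \<Longrightarrow> C i \<subset> C (Suc i)"
    have "\<not> 0 < n" using C(1)[of 0] C(1)[of "Suc 0"] C(2)[of 0] by (metis Suc_leI psubsetE subset_trans zero_le)
    then show "enat n \<le> 0" by (simp add: zero_enat_def)
  qed
  then show ?thesis by simp
qed

section \<open>The modular lattice of submodules and additivity of length\<close>

context module
begin

lemma submodule_zero: "submodule H R M \<Longrightarrow> \<zero>\<^bsub>M\<^esub> \<in> H"
  by (simp add: submodule_def subgroup_def)

lemma submodule_minus: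
  assumes "submodule H R M" "y \<in> H" "z \<in> H"
  shows "y \<ominus>\<^bsub>M\<^esub> z \<in> H"
  using submoduleE[OF assms(1)] assms(2,3) by (simp add: a_minus_def)

lemma mem_set_add: "z \<in> V <+>\<^bsub>M\<^esub> W \<longleftrightarrow> (\<exists>x\<in>V. \<exists>y\<in>W. z = x \<oplus>\<^bsub>M\<^esub> y)"
  by (auto simp: set_add_def')

lemma set_add_upper1: "V \<subseteq> carrier M \<Longrightarrow> submodule W R M \<Longrightarrow> V \<subseteq> V <+>\<^bsub>M\<^esub> W"
  unfolding mem_set_add subset_iff using submodule_zero by (metis M.r_zero)

lemma set_add_upper2: "submodule V R M \<Longrightarrow> W \<subseteq> carrier M \<Longrightarrow> W \<subseteq> V <+>\<^bsub>M\<^esub> W"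
  unfolding mem_set_add subset_iff using submodule_zero by (metis M.l_zero)

lemma set_add_least: "submodule Z R M \<Longrightarrow> V \<subseteq> Z \<Longrightarrow> W \<subseteq> Z \<Longrightarrow> V <+>\<^bsub>M\<^esub> W \<subseteq> Z"
  by (auto simp: mem_set_add subset_iff intro: submoduleE(5))

lemma set_add_submodule:
  assumes V: "submodule V R M" and W: "submodule W R M"
  shows "submodule (V <+>\<^bsub>M\<^esub> W) R M"
proof (rule submoduleI)
  note VE = submoduleE[OF V] and WE = submoduleE[OF W]
  note sub = subsetD[OF VE(1)] subsetD[OF WE(1)]
  show "V <+>\<^bsub>M\<^esub> W \<subseteq> carrier M"
    using VE(1) WE(1) by (intro set_add_least carrier_is_submodule)
  show "\<zero>\<^bsub>M\<^esub> \<in> V <+>\<^bsub>M\<^esub> W"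
    using set_add_upper1[OF VE(1) W] submodule_zero[OF V] by blast
  fix z assume "z \<in> V <+>\<^bsub>M\<^esub> W"
  then obtain u v where uv: "u \<in> V" "v \<in> W" "z = u \<oplus>\<^bsub>M\<^esub> v" unfolding mem_set_add by blast
  show "\<ominus>\<^bsub>M\<^esub> z \<in> V <+>\<^bsub>M\<^esub> W" unfolding mem_set_add
    by (intro bexI[of _ "\<ominus>\<^bsub>M\<^esub> u"] bexI[of _ "\<ominus>\<^bsub>M\<^esub> v"]) (use uv VE WE sub in \<open>auto simp: M.minus_add\<close>)
  { fix a assume "a \<in> carrier R"
    then show "a \<odot>\<^bsub>M\<^esub> z \<in> V <+>\<^bsub>M\<^esub> W" unfolding mem_set_add
      by (intro bexI[of _ "a \<odot>\<^bsub>M\<^esub> u"] bexI[of _ "a \<odot>\<^bsub>M\<^esub> v"])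
         (use uv VE WE sub in \<open>auto simp: smult_r_distr\<close>) }
  fix z' assume "z' \<in> V <+>\<^bsub>M\<^esub> W"
  then obtain u' v' where uv': "u' \<in> V" "v' \<in> W" "z' = u' \<oplus>\<^bsub>M\<^esub> v'" unfolding mem_set_add by blast
  show "z \<oplus>\<^bsub>M\<^esub> z' \<in> V <+>\<^bsub>M\<^esub> W" unfolding mem_set_add
    by (intro bexI[of _ "u \<oplus>\<^bsub>M\<^esub> u'"] bexI[of _ "v \<oplus>\<^bsub>M\<^esub> v'"])
       (use uv uv' VE WE sub in \<open>auto simp: M.a_ac\<close>)
qed

lemma inter_submodule: "submodule V R M \<Longrightarrow> submodule W R M \<Longrightarrow> submodule (V \<inter> W) R M"
  by (rule submoduleI) (simp_all add: submodule_zero submoduleE(3-5) submoduleE(1) le_infI1)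

lemma set_add_absorb:
  assumes "submodule V R M" "submodule W R M" "W \<subseteq> V"
  shows "V <+>\<^bsub>M\<^esub> W = V" "W <+>\<^bsub>M\<^esub> V = V"
  by (intro subset_antisym set_add_least set_add_upper1 set_add_upper2 submoduleE(1) assms subset_refl)+

lemma set_add_mono: "V \<subseteq> V' \<Longrightarrow> W \<subseteq> W' \<Longrightarrow> V <+>\<^bsub>M\<^esub> W \<subseteq> V' <+>\<^bsub>M\<^esub> W'"
  unfolding mem_set_add subset_iff by blast

lemma set_add_comm:
  assumes "V \<subseteq> carrier M" "W \<subseteq> carrier M"
  shows "V <+>\<^bsub>M\<^esub> W = W <+>\<^bsub>M\<^esub> V"
proof -
  have "x \<oplus>\<^bsub>M\<^esub> y = y \<oplus>\<^bsub>M\<^esub> x" if "x \<in> V" "y \<in> W" for x y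
    using that assms M.a_comm by blast
  then show ?thesis unfolding set_eq_iff mem_set_add by metis
qed

lemma modular_law:
  assumes V: "submodule V R M" and B: "submodule B R M" and W: "submodule W R M" and "V \<subseteq> W"
  shows "W \<inter> (V <+>\<^bsub>M\<^esub> B) = V <+>\<^bsub>M\<^esub> (W \<inter> B)"
proof
  show "W \<inter> (V <+>\<^bsub>M\<^esub> B) \<subseteq> V <+>\<^bsub>M\<^esub> (W \<inter> B)"
  proof
    fix z assume "z \<in> W \<inter> (V <+>\<^bsub>M\<^esub> B)"
    then obtain u v where uv: "u \<in> V" "v \<in> B" "z = u \<oplus>\<^bsub>M\<^esub> v" "z \<in> W" by (auto simp: mem_set_add)
    then have "u \<in> carrier M" "v \<in> carrier M" "u \<in> W"
      using submoduleE(1)[OF V] submoduleE(1)[OF B] assms(4) by auto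
    then have "v = z \<ominus>\<^bsub>M\<^esub> u" using uv(3) by (simp add: M.minus_eq M.a_comm[of u v] M.a_assoc M.r_neg)
    then have "v \<in> W" using submodule_minus[OF W] uv(4) \<open>u \<in> W\<close> by simp
    then show "z \<in> V <+>\<^bsub>M\<^esub> (W \<inter> B)" using uv by (auto simp: mem_set_add)
  qed
  show "V <+>\<^bsub>M\<^esub> (W \<inter> B) \<subseteq> W \<inter> (V <+>\<^bsub>M\<^esub> B)"
    using set_add_least[OF W assms(4), of "W \<inter> B"] set_add_mono[of V V "W \<inter> B" B] by auto
qed

text \<open>Apply the modular law to \<open>W\<close> inside \<open>V + B\<close>. This is the form
  of modularity that detects strict steps, in additivity as well as in the second isomorphism
  theorem.\<close>

lemma modular_cancel:
  assumes "submodule V R M" "submodule B R M" "submodule W R M" "V \<subseteq> W"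
    and "W \<inter> B \<subseteq> V \<inter> B" "W <+>\<^bsub>M\<^esub> B \<subseteq> V <+>\<^bsub>M\<^esub> B"
  shows "W \<subseteq> V"
proof -
  have "W \<subseteq> W \<inter> (V <+>\<^bsub>M\<^esub> B)"
    using set_add_upper1[OF submoduleE(1)[OF assms(3)] assms(2)] assms(6) by auto
  also have "\<dots> = V <+>\<^bsub>M\<^esub> (W \<inter> B)" using modular_law assms by simp
  also have "\<dots> \<subseteq> V" using set_add_least[of V V "W \<inter> B"] assms by auto
  finally show ?thesis .
qed

text \<open>By the modular law, each strict step of a chain is strict after intersecting with \<open>B\<close> or
  after adding \<open>B\<close>.\<close>

lemma interval_length_subadd:
  assumes Z: "submodule Z R M" and B: "submodule B R M" and A: "submodule A R M"
    and "Z \<subseteq> B" "B \<subseteq> A"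
  shows "interval_length R M Z A \<le> interval_length R M Z B + interval_length R M B A"
proof (rule interval_length_leI)
  \<comment> \<open>\<open>P\<close> measures a step by its trace in \<open>B\<close> and its image
    modulo \<open>B\<close>. It is superadditive along chains and at least 1 on strict steps, so a
    chain of length n has total measure at least n.\<close>
  define P where "P V W = interval_length R M (V \<inter> B) (W \<inter> B)
    + interval_length R M (V <+>\<^bsub>M\<^esub> B) (W <+>\<^bsub>M\<^esub> B)" for V W
  have P_trans: "P V W + P W U \<le> P V U"
    if "submodule V R M" "submodule W R M" "submodule U R M" "V \<subseteq> W" "W \<subseteq> U" for V W U
  proof -
    have 1: "interval_length R M (V \<inter> B) (W \<inter> B) + interval_length R M (W \<inter> B) (U \<inter> B)
        \<le> interval_length R M (V \<inter> B) (U \<inter> B)"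
      using that B by (intro interval_length_superadd inter_submodule) auto
    have 2: "interval_length R M (V <+>\<^bsub>M\<^esub> B) (W <+>\<^bsub>M\<^esub> B)
        + interval_length R M (W <+>\<^bsub>M\<^esub> B) (U <+>\<^bsub>M\<^esub> B)
        \<le> interval_length R M (V <+>\<^bsub>M\<^esub> B) (U <+>\<^bsub>M\<^esub> B)"
      using that B by (intro interval_length_superadd set_add_submodule set_add_mono) auto
    show ?thesis using add_mono[OF 1 2] by (simp add: P_def ac_simps)
  qed
  have P_pos: "1 \<le> P V W" if "submodule V R M" "submodule W R M" "V \<subset> W" for V W
  proof (cases "V \<inter> B \<subset> W \<inter> B")
    case True
    then have "1 \<le> interval_length R M (V \<inter> B) (W \<inter> B)"
      using that B by (intro interval_length_pos inter_submodule)
    then show ?thesis unfolding P_def by (simp add: add_increasing2)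
  next
    case False
    then have "V <+>\<^bsub>M\<^esub> B \<subset> W <+>\<^bsub>M\<^esub> B"
      using modular_cancel[OF that(1) B that(2)] that(3) set_add_mono[of V W B B] by blast
    then have "1 \<le> interval_length R M (V <+>\<^bsub>M\<^esub> B) (W <+>\<^bsub>M\<^esub> B)"
      using that B by (intro interval_length_pos set_add_submodule)
    then show ?thesis unfolding P_def by (simp add: add_increasing)
  qed
  fix n C
  assume C: "\<And>i. i \<le> n \<Longrightarrow> submodule (C i) R M \<and> Z \<subseteq> C i \<and> C i \<subseteq> A"
    and strict: "\<And>i. i < n \<Longrightarrow> C i \<subset> C (Suc i)"
  have "j \<le> n \<Longrightarrow> C 0 \<subseteq> C j \<and> enat j \<le> P (C 0) (C j)" for j
  proof (induction j)
    case 0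
    then show ?case by (simp add: zero_enat_def[symmetric])
  next
    case (Suc j)
    have "enat (Suc j) = enat j + 1" by (simp add: one_enat_def)
    also have "\<dots> \<le> P (C 0) (C j) + P (C j) (C (Suc j))"
      using Suc C[of j] C[of "Suc j"] strict[of j] by (intro add_mono P_pos) auto
    also have "\<dots> \<le> P (C 0) (C (Suc j))"
      using Suc C[of 0] C[of j] C[of "Suc j"] strict[of j] by (intro P_trans) auto
    finally show ?case using Suc strict[of j] by auto
  qed
  then have "enat n \<le> P (C 0) (C n)" by simp
  also have "\<dots> \<le> interval_length R M Z B + interval_length R M B A"
  proof -
    have 0: "submodule (C 0) R M" "Z \<subseteq> C 0" and n: "submodule (C n) R M" "C n \<subseteq> A"
      using C[of 0] C[of n] by auto
    show ?thesis unfolding P_def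
      using 0 n assms set_add_upper2[OF 0(1) submoduleE(1)[OF B]] set_add_least[OF A n(2)]
      by (intro add_mono interval_length_mono) auto
  qed
  finally show "enat n \<le> interval_length R M Z B + interval_length R M B A" .
qed

lemma interval_length_add:
  assumes "submodule Z R M" "submodule B R M" "submodule A R M" "Z \<subseteq> B" "B \<subseteq> A"
  shows "interval_length R M Z A = interval_length R M Z B + interval_length R M B A"
  using interval_length_subadd[OF assms] interval_length_superadd[OF assms(2-5)] by (rule antisym)

text \<open>Intersecting with \<open>A\<close> and adding \<open>B\<close> are the two maps of
  submodules. Each yields one inequality, so that they need not be shown to be mutually
  inverse.\<close>

lemma interval_length_second_iso:
  assumes A: "submodule A R M" and B: "submodule B R M"
  shows "interval_length R M B (A <+>\<^bsub>M\<^esub> B) = interval_length R M (A \<inter> B) A"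
proof (rule antisym)
  show "interval_length R M B (A <+>\<^bsub>M\<^esub> B) \<le> interval_length R M (A \<inter> B) A"
  proof (rule interval_length_map[where g = "\<lambda>V. V \<inter> A"])
    fix V W
    assume V: "submodule V R M" and W: "submodule W R M" and 1: "B \<subseteq> V" "V \<subseteq> W" "W \<subseteq> A <+>\<^bsub>M\<^esub> B"
      and 2: "W \<inter> A \<subseteq> V \<inter> A"
    \<comment> \<open>Since \<open>V\<close> contains \<open>B\<close> and \<open>W\<close> lies in
      \<open>A + B\<close>, both have the same sum with \<open>A\<close>; equal traces on
      \<open>A\<close> then leave no room between them.\<close>
    have "W <+>\<^bsub>M\<^esub> A \<subseteq> A <+>\<^bsub>M\<^esub> B"
      using 1 A B by (intro set_add_least set_add_submodule set_add_upper1 submoduleE(1))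
    also have "\<dots> \<subseteq> V <+>\<^bsub>M\<^esub> A"
      using 1 A V set_add_upper1[OF submoduleE(1)[OF V] A]
      by (intro set_add_least set_add_submodule set_add_upper2 submoduleE(1)) auto
    finally show "W \<subseteq> V" using modular_cancel[OF V A W] 1 2 by simp
  qed (use A inter_submodule in auto)
  show "interval_length R M (A \<inter> B) A \<le> interval_length R M B (A <+>\<^bsub>M\<^esub> B)"
  proof (rule interval_length_map[where g = "\<lambda>V. V <+>\<^bsub>M\<^esub> B"])
    fix V W
    assume "submodule V R M" "submodule W R M" "A \<inter> B \<subseteq> V" "V \<subseteq> W" "W \<subseteq> A"
      "W <+>\<^bsub>M\<^esub> B \<subseteq> V <+>\<^bsub>M\<^esub> B"
    then show "W \<subseteq> V" using modular_cancel[of V B W] B by blast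
  qed (use B set_add_submodule set_add_mono set_add_upper2 submoduleE(1) in auto)
qed

end

subsection \<open>Linear maps and quotients\<close>

lemma (in module) submoduleI':
  assumes "H \<subseteq> carrier M" and "\<zero>\<^bsub>M\<^esub> \<in> H"
    and "\<And>y z. y \<in> H \<Longrightarrow> z \<in> H \<Longrightarrow> y \<oplus>\<^bsub>M\<^esub> z \<in> H"
    and "\<And>a y. a \<in> carrier R \<Longrightarrow> y \<in> H \<Longrightarrow> a \<odot>\<^bsub>M\<^esub> y \<in> H"
  shows "submodule H R M"
proof (rule submoduleI[OF assms(1,2) _ assms(3,4)])
  fix y assume y: "y \<in> H"
  have "\<ominus>\<^bsub>M\<^esub> y = (\<ominus> \<one>) \<odot>\<^bsub>M\<^esub> y" using y assms(1) by (simp add: smult_l_minus subset_iff)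
  then show "\<ominus>\<^bsub>M\<^esub> y \<in> H" using assms(4)[of "\<ominus> \<one>", OF _ y] by simp
qed

text \<open>Two instances matter: the coset map onto a quotient, and multiplication by a ring
  element as an endomorphism of M, which is linear because R is commutative.\<close>

locale module_map = dom: module R M + cod: module R N
  for R :: "('a, 'r) ring_scheme" and M :: "('a, 'b, 'm) module_scheme"
    and N :: "('a, 'c, 'n) module_scheme" +
  fixes f :: "'b \<Rightarrow> 'c"
  assumes closed: "y \<in> carrier M \<Longrightarrow> f y \<in> carrier N"
    and additive: "y \<in> carrier M \<Longrightarrow> z \<in> carrier M \<Longrightarrow> f (y \<oplus>\<^bsub>M\<^esub> z) = f y \<oplus>\<^bsub>N\<^esub> f z"
    and linear: "a \<in> carrier R \<Longrightarrow> y \<in> carrier M \<Longrightarrow> f (a \<odot>\<^bsub>M\<^esub> y) = a \<odot>\<^bsub>N\<^esub> f y"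
begin

lemma map_zero: "f \<zero>\<^bsub>M\<^esub> = \<zero>\<^bsub>N\<^esub>"
  using linear[of "\<zero>\<^bsub>R\<^esub>" "\<zero>\<^bsub>M\<^esub>"] closed[of "\<zero>\<^bsub>M\<^esub>"] by simp

lemma map_diff:
  assumes "y \<in> carrier M" "z \<in> carrier M"
  shows "f (y \<ominus>\<^bsub>M\<^esub> z) = f y \<ominus>\<^bsub>N\<^esub> f z"
proof -
  have "f (\<ominus>\<^bsub>M\<^esub> z) = \<ominus>\<^bsub>N\<^esub> f z"
    using linear[of "\<ominus>\<^bsub>R\<^esub> \<one>\<^bsub>R\<^esub>" z] closed[OF assms(2)] assms(2)
    by (simp add: dom.smult_l_minus cod.smult_l_minus)
  then show ?thesis using additive[of y "\<ominus>\<^bsub>M\<^esub> z"] assms by (simp add: a_minus_def)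
qed

lemma vimage_submodule:
  assumes "submodule V R N"
  shows "submodule {y \<in> carrier M. f y \<in> V} R M"
proof (rule dom.submoduleI')
  show "\<zero>\<^bsub>M\<^esub> \<in> {y \<in> carrier M. f y \<in> V}"
    using cod.submodule_zero[OF assms] by (simp add: map_zero)
qed (use cod.submoduleE[OF assms] in \<open>auto simp: additive linear\<close>)

lemma image_submodule:
  assumes V: "submodule V R M"
  shows "submodule (f ` V) R N"
proof (rule cod.submoduleI')
  note VE = dom.submoduleE[OF V]
  note car = subsetD[OF VE(1)]
  show "f ` V \<subseteq> carrier N" using VE(1) closed by blast
  show "\<zero>\<^bsub>N\<^esub> \<in> f ` V" using dom.submodule_zero[OF V] map_zero by (metis imageI)
  fix y assume "y \<in> f ` V"
  then obtain u where u: "u \<in> V" "y = f u" by blast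
  { fix a assume "a \<in> carrier R"
    then show "a \<odot>\<^bsub>N\<^esub> y \<in> f ` V"
      using u VE(4)[of a u] linear[of a u] car[of u] by (metis imageI) }
  fix z assume "z \<in> f ` V"
  then obtain v where v: "v \<in> V" "z = f v" by blast
  show "y \<oplus>\<^bsub>N\<^esub> z \<in> f ` V"
    using u v VE(5)[of u v] additive[of u v] car[of u] car[of v] by (metis imageI)
qed

lemma image_diff_kernel:
  assumes "y \<in> carrier M" "z \<in> carrier M" "f y = f z"
  shows "f (y \<ominus>\<^bsub>M\<^esub> z) = \<zero>\<^bsub>N\<^esub>"
  using map_diff[OF assms(1,2)] closed[OF assms(2)] assms(3) by (simp add: cod.M.minus_eq cod.M.r_neg)

text \<open>The correspondence theorem for lengths. Surjectivity is required only onto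
  \<open>A\<close>, so that multiplication by x, with image xM, is also covered.\<close>

lemma interval_length_vimage:
  assumes B: "submodule B R N" and A: "submodule A R N" and "B \<subseteq> A" "A \<subseteq> f ` carrier M"
  shows "interval_length R M {y \<in> carrier M. f y \<in> B} {y \<in> carrier M. f y \<in> A}
    = interval_length R N B A"
proof (rule antisym)
  show "interval_length R N B A
      \<le> interval_length R M {y \<in> carrier M. f y \<in> B} {y \<in> carrier M. f y \<in> A}"
  proof (rule interval_length_map[where g = "\<lambda>V. {y \<in> carrier M. f y \<in> V}"])
    fix V W
    assume "V \<subseteq> W" "W \<subseteq> A" "{y \<in> carrier M. f y \<in> W} \<subseteq> {y \<in> carrier M. f y \<in> V}"
    then show "W \<subseteq> V" using assms(4) by blast
  qed (use vimage_submodule in auto)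
  show "interval_length R M {y \<in> carrier M. f y \<in> B} {y \<in> carrier M. f y \<in> A}
      \<le> interval_length R N B A"
  proof (rule interval_length_map[where g = "\<lambda>V. f ` V"])
    fix V assume "submodule V R M" "{y \<in> carrier M. f y \<in> B} \<subseteq> V" "V \<subseteq> {y \<in> carrier M. f y \<in> A}"
    then show "submodule (f ` V) R N \<and> B \<subseteq> f ` V \<and> f ` V \<subseteq> A"
      using image_submodule assms(3,4) by blast
  next
    fix V W
    assume V: "submodule V R M" and W: "submodule W R M" and "V \<subseteq> W"
      and *: "{y \<in> carrier M. f y \<in> B} \<subseteq> V" "f ` W \<subseteq> f ` V"
    show "W \<subseteq> V"
    proof
      fix y assume y: "y \<in> W"
      then obtain z where z: "z \<in> V" "f y = f z" using * by blast
      have car: "y \<in> carrier M" "z \<in> carrier M" using y z V W dom.submoduleE(1) by blast+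
      \<comment> \<open>The difference lies in the kernel, hence in the preimage of
        \<open>B\<close>, which \<open>V\<close> contains.\<close>
      then have "y \<ominus>\<^bsub>M\<^esub> z \<in> V"
        using * image_diff_kernel[OF car z(2)] cod.submodule_zero[OF B] by auto
      then have "(y \<ominus>\<^bsub>M\<^esub> z) \<oplus>\<^bsub>M\<^esub> z \<in> V" using z V dom.submoduleE(5) by blast
      then show "y \<in> V" using car by (simp add: a_minus_def dom.M.a_assoc dom.M.l_neg)
    qed
  qed auto
qed

lemma vimage_image:
  assumes A: "submodule A R M"
  shows "{y \<in> carrier M. f y \<in> f ` A} = A <+>\<^bsub>M\<^esub> {y \<in> carrier M. f y = \<zero>\<^bsub>N\<^esub>}"
proof
  show "A <+>\<^bsub>M\<^esub> {y \<in> carrier M. f y = \<zero>\<^bsub>N\<^esub>} \<subseteq> {y \<in> carrier M. f y \<in> f ` A}"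
    using dom.submoduleE(1)[OF A] closed by (auto simp: dom.mem_set_add additive subset_iff)
  show "{y \<in> carrier M. f y \<in> f ` A} \<subseteq> A <+>\<^bsub>M\<^esub> {y \<in> carrier M. f y = \<zero>\<^bsub>N\<^esub>}"
  proof
    fix y assume "y \<in> {y \<in> carrier M. f y \<in> f ` A}"
    then obtain z where z: "y \<in> carrier M" "z \<in> A" "f y = f z" by blast
    then have car: "z \<in> carrier M" using dom.submoduleE(1)[OF A] by blast
    then have "y = z \<oplus>\<^bsub>M\<^esub> (y \<ominus>\<^bsub>M\<^esub> z)"
      using z by (simp add: a_minus_def dom.M.a_lcomm[of z y] dom.M.r_neg)
    then show "y \<in> A <+>\<^bsub>M\<^esub> {y \<in> carrier M. f y = \<zero>\<^bsub>N\<^esub>}"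
      unfolding dom.mem_set_add using z image_diff_kernel[OF z(1) car z(3)] car by blast
  qed
qed

lemma image_set_add:
  assumes "V \<subseteq> carrier M" "W \<subseteq> carrier M"
  shows "f ` (V <+>\<^bsub>M\<^esub> W) = f ` V <+>\<^bsub>N\<^esub> f ` W"
proof
  show "f ` (V <+>\<^bsub>M\<^esub> W) \<subseteq> f ` V <+>\<^bsub>N\<^esub> f ` W"
  proof
    fix z assume "z \<in> f ` (V <+>\<^bsub>M\<^esub> W)"
    then obtain v w where vw: "v \<in> V" "w \<in> W" "z = f (v \<oplus>\<^bsub>M\<^esub> w)" by (auto simp: dom.mem_set_add)
    then have "z = f v \<oplus>\<^bsub>N\<^esub> f w" using assms additive by (auto simp: subset_iff)
    then show "z \<in> f ` V <+>\<^bsub>N\<^esub> f ` W" unfolding cod.mem_set_add using vw by blast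
  qed
  show "f ` V <+>\<^bsub>N\<^esub> f ` W \<subseteq> f ` (V <+>\<^bsub>M\<^esub> W)"
  proof
    fix z assume "z \<in> f ` V <+>\<^bsub>N\<^esub> f ` W"
    then obtain v w where "v \<in> V" "w \<in> W" "z = f v \<oplus>\<^bsub>N\<^esub> f w" by (auto simp: cod.mem_set_add)
    then have "z = f (v \<oplus>\<^bsub>M\<^esub> w)" "v \<oplus>\<^bsub>M\<^esub> w \<in> V <+>\<^bsub>M\<^esub> W"
      using assms additive by (auto simp: dom.mem_set_add subset_iff)
    then show "z \<in> f ` (V <+>\<^bsub>M\<^esub> W)" by blast
  qed
qed

end

section \<open>Quotient modules and their lengths\<close>

context module
begin

lemma submodule_abelian_subgroup: "submodule N R M \<Longrightarrow> abelian_subgroup N M"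
  by (intro abelian_subgroupI3 additive_subgroupI M.abelian_group_axioms)
     (simp add: submodule_def)

text \<open>The union in \<open>quotient_module\<close> runs over all representatives. Scaling keeps
  \<open>N\<close> inside itself, so all of them give one coset and the union collapses.\<close>

lemma quotient_smult:
  assumes N: "submodule N R M" and a: "a \<in> carrier R" and y: "y \<in> carrier M"
  shows "(\<Union>z\<in>N +>\<^bsub>M\<^esub> y. N +>\<^bsub>M\<^esub> (a \<odot>\<^bsub>M\<^esub> z)) = N +>\<^bsub>M\<^esub> (a \<odot>\<^bsub>M\<^esub> y)"
proof -
  interpret N: abelian_subgroup N M by (rule submodule_abelian_subgroup[OF N])
  have "N +>\<^bsub>M\<^esub> (a \<odot>\<^bsub>M\<^esub> z) = N +>\<^bsub>M\<^esub> (a \<odot>\<^bsub>M\<^esub> y)" if z: "z \<in> N +>\<^bsub>M\<^esub> y" for z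
  proof -
    obtain n where n: "n \<in> N" "z = n \<oplus>\<^bsub>M\<^esub> y" using z by (auto simp: a_r_coset_def')
    then have "a \<odot>\<^bsub>M\<^esub> z = a \<odot>\<^bsub>M\<^esub> n \<oplus>\<^bsub>M\<^esub> a \<odot>\<^bsub>M\<^esub> y"
      using a y submoduleE(1)[OF N] by (simp add: smult_r_distr subset_iff)
    then have "a \<odot>\<^bsub>M\<^esub> z \<in> N +>\<^bsub>M\<^esub> (a \<odot>\<^bsub>M\<^esub> y)"
      using submoduleE(4)[OF N a n(1)] by (auto simp: a_r_coset_def')
    then show ?thesis using M.a_repr_independence[OF _ _ N.a_subgroup] a y by simp
  qed
  then show ?thesis by (intro SUP_eq_const) (use N.a_rcos_self[OF y] in blast)+
qed

lemma quotient_is_module: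
  assumes N: "submodule N R M"
  shows "module R (quotient_module M N)"
proof -
  interpret N: abelian_subgroup N M by (rule submodule_abelian_subgroup[OF N])
  let ?Q = "quotient_module M N"
  have [simp]: "carrier ?Q = a_rcosets\<^bsub>M\<^esub> N" "add ?Q = set_add M"
    "\<And>a Y. a \<odot>\<^bsub>?Q\<^esub> Y = (\<Union>y\<in>Y. N +>\<^bsub>M\<^esub> (a \<odot>\<^bsub>M\<^esub> y))"
    by (simp_all add: quotient_module_def)
  have coset: "\<exists>y\<in>carrier M. Y = N +>\<^bsub>M\<^esub> y" if "Y \<in> a_rcosets\<^bsub>M\<^esub> N" for Y
    using that by (auto simp: A_RCOSETS_def')
  \<comment> \<open>These rewrite operations on cosets into operations on representatives, so each
    module axiom reduces to the same axiom of M.\<close>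
  note rules = quotient_smult[OF N] N.a_rcos_sum smult_closed M.add.m_closed M.a_rcosetsI[OF N.a_subset]
  have abelian: "abelian_group ?Q"
  proof (rule abelian_groupI)
    have zero: "\<zero>\<^bsub>?Q\<^esub> = N +>\<^bsub>M\<^esub> \<zero>\<^bsub>M\<^esub>"
      using N.a_subset by (simp add: quotient_module_def)
    show "\<zero>\<^bsub>?Q\<^esub> \<in> carrier ?Q" by (simp add: zero rules)
    fix Y assume "Y \<in> carrier ?Q"
    then obtain y where y: "y \<in> carrier M" "Y = N +>\<^bsub>M\<^esub> y" using coset by auto
    show "\<zero>\<^bsub>?Q\<^esub> \<oplus>\<^bsub>?Q\<^esub> Y = Y" using y by (simp add: zero rules)
    have "N +>\<^bsub>M\<^esub> (\<ominus>\<^bsub>M\<^esub> y) \<in> carrier ?Q" using y by (simp add: rules)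
    moreover have "(N +>\<^bsub>M\<^esub> (\<ominus>\<^bsub>M\<^esub> y)) \<oplus>\<^bsub>?Q\<^esub> Y = \<zero>\<^bsub>?Q\<^esub>"
      using y by (simp add: zero rules M.l_neg)
    ultimately show "\<exists>Z\<in>carrier ?Q. Z \<oplus>\<^bsub>?Q\<^esub> Y = \<zero>\<^bsub>?Q\<^esub>" by blast
    fix Z assume "Z \<in> carrier ?Q"
    then obtain z where z: "z \<in> carrier M" "Z = N +>\<^bsub>M\<^esub> z" using coset by auto
    show "Y \<oplus>\<^bsub>?Q\<^esub> Z \<in> carrier ?Q" using y z by (simp add: rules)
    show "Y \<oplus>\<^bsub>?Q\<^esub> Z = Z \<oplus>\<^bsub>?Q\<^esub> Y" using y z by (simp add: rules M.a_comm)
    fix U assume "U \<in> carrier ?Q"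
    then obtain u where u: "u \<in> carrier M" "U = N +>\<^bsub>M\<^esub> u" using coset by auto
    show "Y \<oplus>\<^bsub>?Q\<^esub> Z \<oplus>\<^bsub>?Q\<^esub> U = Y \<oplus>\<^bsub>?Q\<^esub> (Z \<oplus>\<^bsub>?Q\<^esub> U)" using y z u by (simp add: rules M.a_assoc)
  qed
  show ?thesis
  proof (rule moduleI[OF R.is_cring abelian])
    fix a Y assume a: "a \<in> carrier R" and "Y \<in> carrier ?Q"
    then obtain y where y: "y \<in> carrier M" "Y = N +>\<^bsub>M\<^esub> y" using coset by auto
    show "a \<odot>\<^bsub>?Q\<^esub> Y \<in> carrier ?Q" using a y by (simp add: rules)
    { fix b assume b: "b \<in> carrier R"
      show "(a \<oplus> b) \<odot>\<^bsub>?Q\<^esub> Y = a \<odot>\<^bsub>?Q\<^esub> Y \<oplus>\<^bsub>?Q\<^esub> b \<odot>\<^bsub>?Q\<^esub> Y"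
        using a b y by (simp add: rules smult_l_distr)
      show "(a \<otimes> b) \<odot>\<^bsub>?Q\<^esub> Y = a \<odot>\<^bsub>?Q\<^esub> (b \<odot>\<^bsub>?Q\<^esub> Y)"
        using a b y by (simp add: rules smult_assoc1) }
    fix Z assume "Z \<in> carrier ?Q"
    then obtain z where z: "z \<in> carrier M" "Z = N +>\<^bsub>M\<^esub> z" using coset by auto
    show "a \<odot>\<^bsub>?Q\<^esub> (Y \<oplus>\<^bsub>?Q\<^esub> Z) = a \<odot>\<^bsub>?Q\<^esub> Y \<oplus>\<^bsub>?Q\<^esub> a \<odot>\<^bsub>?Q\<^esub> Z"
      using a y z by (simp add: rules smult_r_distr)
  next
    fix Y assume "Y \<in> carrier ?Q"
    then obtain y where y: "y \<in> carrier M" "Y = N +>\<^bsub>M\<^esub> y" using coset by auto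
    then show "\<one> \<odot>\<^bsub>?Q\<^esub> Y = Y" by (simp add: rules)
  qed
qed

lemma quotient_map:
  assumes N: "submodule N R M"
  shows "module_map R M (quotient_module M N) (\<lambda>y. N +>\<^bsub>M\<^esub> y)"
proof -
  interpret N: abelian_subgroup N M by (rule submodule_abelian_subgroup[OF N])
  show ?thesis
    by (intro module_map.intro module_map_axioms.intro module_axioms quotient_is_module[OF N])
       (auto simp: quotient_module_def N.a_rcos_sum quotient_smult[OF N] M.a_rcosetsI[OF N.a_subset])
qed

lemma quotient_map_kernel:
  assumes N: "submodule N R M"
  shows "{y \<in> carrier M. N +>\<^bsub>M\<^esub> y = \<zero>\<^bsub>quotient_module M N\<^esub>} = N"
proof -
  interpret N: abelian_subgroup N M by (rule submodule_abelian_subgroup[OF N])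
  show ?thesis
    using M.a_coset_join1[OF _ _ N.a_subgroup] M.a_coset_join2[OF _ N.a_subgroup] N.a_subset
    by (auto simp: quotient_module_def)
qed

lemma quotient_map_image: "(\<lambda>y. N +>\<^bsub>M\<^esub> y) ` carrier M = carrier (quotient_module M N)"
  by (auto simp: quotient_module_def A_RCOSETS_def')

lemma zero_submodule: "submodule {\<zero>\<^bsub>M\<^esub>} R M"
  by (rule submoduleI') auto

lemma module_length_eq: "module_length R M = interval_length R M {\<zero>\<^bsub>M\<^esub>} (carrier M)"
proof -
  have "submodule V R M \<and> {\<zero>\<^bsub>M\<^esub>} \<subseteq> V \<and> V \<subseteq> carrier M \<longleftrightarrow> submodule V R M" for V
    using submodule_zero submoduleE(1) by blast
  then show ?thesis unfolding module_length_def interval_length_def by simp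
qed

lemma module_length_quotient:
  assumes N: "submodule N R M"
  shows "module_length R (quotient_module M N) = interval_length R M N (carrier M)"
proof -
  interpret Q: module_map R M "quotient_module M N" "\<lambda>y. N +>\<^bsub>M\<^esub> y" by (rule quotient_map[OF N])
  let ?Q = "quotient_module M N"
  have "module_length R ?Q = interval_length R ?Q {\<zero>\<^bsub>?Q\<^esub>} (carrier ?Q)"
    by (rule Q.cod.module_length_eq)
  also have "\<dots> = interval_length R M {y \<in> carrier M. N +>\<^bsub>M\<^esub> y \<in> {\<zero>\<^bsub>?Q\<^esub>}}
      {y \<in> carrier M. N +>\<^bsub>M\<^esub> y \<in> carrier ?Q}"
    by (rule Q.interval_length_vimage[symmetric])
       (simp_all add: Q.cod.zero_submodule Q.cod.carrier_is_submodule quotient_map_image)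
  also have "\<dots> = interval_length R M N (carrier M)"
    using quotient_map_kernel[OF N] Q.closed by (simp cong: conj_cong)
  finally show ?thesis .
qed

lemma submodule_restrict_iff:
  assumes A: "submodule A R M" and "V \<subseteq> A"
  shows "submodule V R (M\<lparr>carrier := A\<rparr>) \<longleftrightarrow> submodule V R M"
proof -
  interpret A: module R "M\<lparr>carrier := A\<rparr>" by (rule submodule.submodule_is_module[OF A module_axioms])
  show ?thesis
  proof
    assume V: "submodule V R (M\<lparr>carrier := A\<rparr>)"
    show "submodule V R M"
      using A.submoduleE[OF V] A.submodule_zero[OF V] submoduleE(1)[OF A]
      by (intro submoduleI') auto
  next
    assume V: "submodule V R M"
    show "submodule V R (M\<lparr>carrier := A\<rparr>)"
      using submoduleE[OF V] submodule_zero[OF V] assms(2)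
      by (intro A.submoduleI') auto
  qed
qed

text \<open>The bridge from the lengths in the theorem to intervals in M: neither restricting the
  carrier to \<open>A\<close> nor passing to cosets of \<open>B\<close> changes the available
  chains.\<close>

lemma quot_length_eq:
  assumes A: "submodule A R M" and B: "submodule B R M" and "B \<subseteq> A"
  shows "quot_length R M A B = interval_length R M B A"
proof -
  interpret A: module R "M\<lparr>carrier := A\<rparr>" by (rule submodule.submodule_is_module[OF A module_axioms])
  have "quot_length R M A B = interval_length R (M\<lparr>carrier := A\<rparr>) B A"
    unfolding quot_length_def
    using A.module_length_quotient[of B] submodule_restrict_iff[OF A assms(3)] B by simp
  also have "\<dots> = interval_length R M B A"
  proof -
    have "submodule V R (M\<lparr>carrier := A\<rparr>) \<and> B \<subseteq> V \<and> V \<subseteq> A \<longleftrightarrow> submodule V R M \<and> B \<subseteq> V \<and> V \<subseteq> A" for V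
      using submodule_restrict_iff[OF A] by blast
    then show ?thesis unfolding interval_length_def by simp
  qed
  finally show ?thesis .
qed

end

subsection \<open>Products of ideals and submodules\<close>

context module
begin

lemma submodule_span_submodule: "S \<subseteq> carrier M \<Longrightarrow> submodule (submodule_span R M S) R M"
  unfolding submodule_span_def
  by (rule submoduleI') (use carrier_is_submodule in \<open>auto simp: submodule_zero submoduleE(4,5)\<close>)

lemma ideal_smult_submodule:
  assumes "J \<subseteq> carrier R" "N \<subseteq> carrier M"
  shows "submodule (ideal_smult R M J N) R M"
  unfolding ideal_smult_def by (rule submodule_span_submodule) (use assms in blast)

lemma ideal_smult_mem: "a \<in> J \<Longrightarrow> y \<in> N \<Longrightarrow> a \<odot>\<^bsub>M\<^esub> y \<in> ideal_smult R M J N"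
  unfolding ideal_smult_def submodule_span_def by blast

lemma ideal_smult_least:
  assumes "submodule P R M" "\<And>a y. a \<in> J \<Longrightarrow> y \<in> N \<Longrightarrow> a \<odot>\<^bsub>M\<^esub> y \<in> P"
  shows "ideal_smult R M J N \<subseteq> P"
  unfolding ideal_smult_def submodule_span_def using assms by blast

lemma ideal_smult_mono: "J \<subseteq> J' \<Longrightarrow> N \<subseteq> N' \<Longrightarrow> ideal_smult R M J N \<subseteq> ideal_smult R M J' N'"
  unfolding ideal_smult_def submodule_span_def by blast

lemma ideal_smult_subset: "J \<subseteq> carrier R \<Longrightarrow> submodule N R M \<Longrightarrow> ideal_smult R M J N \<subseteq> N"
  using submoduleE(4) by (intro ideal_smult_least) auto

lemma ideal_subset: "ideal J R \<Longrightarrow> J \<subseteq> carrier R"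
  by (simp add: additive_subgroup.a_subset ideal.axioms(1))

lemma scaling_map: "a \<in> carrier R \<Longrightarrow> module_map R M M (\<lambda>y. a \<odot>\<^bsub>M\<^esub> y)"
  by unfold_locales (auto simp: smult_r_distr smult_assoc1[symmetric] R.m_comm)

lemma ideal_smult_prod:
  assumes J: "ideal J R" and K: "ideal K R" and N: "N \<subseteq> carrier M"
  shows "ideal_smult R M J (ideal_smult R M K N) = ideal_smult R M (J \<cdot>\<^bsub>R\<^esub> K) N"
proof
  note sub = ideal_subset[OF J] ideal_subset[OF K]
  have JK: "J \<cdot>\<^bsub>R\<^esub> K \<subseteq> carrier R" using R.ideal_prod_in_carrier[OF J K] .
  show "ideal_smult R M J (ideal_smult R M K N) \<subseteq> ideal_smult R M (J \<cdot>\<^bsub>R\<^esub> K) N"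
  proof (rule ideal_smult_least[OF ideal_smult_submodule[OF JK N]])
    fix a y assume a: "a \<in> J" and y: "y \<in> ideal_smult R M K N"
    interpret a: module_map R M M "\<lambda>y. a \<odot>\<^bsub>M\<^esub> y" using scaling_map a sub by blast
    \<comment> \<open>For fixed \<open>a\<close> the elements that \<open>a\<close> sends into (JK)N
      form a submodule, so testing the generators of KN is enough.\<close>
    have "ideal_smult R M K N \<subseteq> {y \<in> carrier M. a \<odot>\<^bsub>M\<^esub> y \<in> ideal_smult R M (J \<cdot>\<^bsub>R\<^esub> K) N}"
    proof (rule ideal_smult_least[OF a.vimage_submodule[OF ideal_smult_submodule[OF JK N]]])
      fix b z assume b: "b \<in> K" and z: "z \<in> N"
      have "(a \<otimes> b) \<odot>\<^bsub>M\<^esub> z \<in> ideal_smult R M (J \<cdot>\<^bsub>R\<^esub> K) N"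
        using ideal_smult_mem[OF ideal_prod.prod[OF a b] z] .
      then show "b \<odot>\<^bsub>M\<^esub> z \<in> {y \<in> carrier M. a \<odot>\<^bsub>M\<^esub> y \<in> ideal_smult R M (J \<cdot>\<^bsub>R\<^esub> K) N}"
        using a b z sub N by (auto simp: smult_assoc1 subset_iff)
    qed
    then show "a \<odot>\<^bsub>M\<^esub> y \<in> ideal_smult R M (J \<cdot>\<^bsub>R\<^esub> K) N" using y by blast
  qed
  have P: "submodule (ideal_smult R M J (ideal_smult R M K N)) R M"
    by (intro ideal_smult_submodule submoduleE(1) sub N)
  show "ideal_smult R M (J \<cdot>\<^bsub>R\<^esub> K) N \<subseteq> ideal_smult R M J (ideal_smult R M K N)"
  proof (rule ideal_smult_least[OF P])
    fix c y assume c: "c \<in> J \<cdot>\<^bsub>R\<^esub> K" and y: "y \<in> N"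
    \<comment> \<open>Membership in the carrier is carried along so that distributivity is available
      in the case of a sum.\<close>
    have "c \<in> carrier R \<and> c \<odot>\<^bsub>M\<^esub> y \<in> ideal_smult R M J (ideal_smult R M K N)"
      using c
    proof (induction c rule: ideal_prod.induct)
      case (prod a b)
      then have "a \<odot>\<^bsub>M\<^esub> (b \<odot>\<^bsub>M\<^esub> y) \<in> ideal_smult R M J (ideal_smult R M K N)"
        using y by (intro ideal_smult_mem)
      then show ?case using prod y sub N by (auto simp: smult_assoc1 subset_iff)
    next
      case (sum a b)
      then show ?case using y N submoduleE(5)[OF P] by (auto simp: smult_l_distr subset_iff)
    qed
    then show "c \<odot>\<^bsub>M\<^esub> y \<in> ideal_smult R M J (ideal_smult R M K N)" by blast
  qed
qed

text \<open>Lets powers of q and of I be exchanged, which is what turns q^(s+1) I^t M + I^(t+1) M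
  into I^t applied to a fixed submodule.\<close>

lemma ideal_smult_commute:
  assumes "ideal J R" "ideal K R" "N \<subseteq> carrier M"
  shows "ideal_smult R M J (ideal_smult R M K N) = ideal_smult R M K (ideal_smult R M J N)"
  using assms by (simp add: ideal_smult_prod R.ideal_prod_commute[of J K])

lemma ideal_smult_set_add:
  assumes J: "J \<subseteq> carrier R" and V: "submodule V R M" and W: "submodule W R M"
  shows "ideal_smult R M J (V <+>\<^bsub>M\<^esub> W) = ideal_smult R M J V <+>\<^bsub>M\<^esub> ideal_smult R M J W"
proof
  note VW = submoduleE(1)[OF V] submoduleE(1)[OF W]
  note S = ideal_smult_submodule[OF J VW(1)] ideal_smult_submodule[OF J VW(2)]
  show "ideal_smult R M J (V <+>\<^bsub>M\<^esub> W) \<subseteq> ideal_smult R M J V <+>\<^bsub>M\<^esub> ideal_smult R M J W"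
  proof (rule ideal_smult_least[OF set_add_submodule[OF S]])
    fix a y assume a: "a \<in> J" and "y \<in> V <+>\<^bsub>M\<^esub> W"
    then obtain v w where vw: "v \<in> V" "w \<in> W" "y = v \<oplus>\<^bsub>M\<^esub> w" by (auto simp: mem_set_add)
    then have "a \<odot>\<^bsub>M\<^esub> y = a \<odot>\<^bsub>M\<^esub> v \<oplus>\<^bsub>M\<^esub> a \<odot>\<^bsub>M\<^esub> w"
      using a J VW by (auto simp: smult_r_distr subset_iff)
    then show "a \<odot>\<^bsub>M\<^esub> y \<in> ideal_smult R M J V <+>\<^bsub>M\<^esub> ideal_smult R M J W"
      unfolding mem_set_add using a vw ideal_smult_mem by blast
  qed
  show "ideal_smult R M J V <+>\<^bsub>M\<^esub> ideal_smult R M J W \<subseteq> ideal_smult R M J (V <+>\<^bsub>M\<^esub> W)"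
    by (intro set_add_least ideal_smult_submodule submoduleE(1) set_add_submodule
        ideal_smult_mono subset_refl J V W set_add_upper1 set_add_upper2 VW)
qed

lemma ideal_pow_ideal:
  assumes "ideal J R" shows "ideal (J [^]\<^bsub>ideals_set R\<^esub> (n::nat)) R"
proof -
  interpret S: comm_monoid "ideals_set R" by (rule R.ideals_set_is_comm_monoid)
  have "J [^]\<^bsub>ideals_set R\<^esub> n \<in> carrier (ideals_set R)"
    by (rule S.nat_pow_closed) (simp add: ideals_set_def assms)
  then show ?thesis by (simp add: ideals_set_def)
qed

lemma ideal_pow_smult_0:
  assumes N: "submodule N R M"
  shows "ideal_pow_smult R M J 0 N = N"
proof
  have pow: "J [^]\<^bsub>ideals_set R\<^esub> (0::nat) = carrier R" by (simp add: ideals_set_def)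
  show "ideal_pow_smult R M J 0 N \<subseteq> N"
    unfolding ideal_pow_smult_def pow using N by (simp add: ideal_smult_subset)
  show "N \<subseteq> ideal_pow_smult R M J 0 N"
    unfolding ideal_pow_smult_def pow
    using ideal_smult_mem[OF R.one_closed] submoduleE(1)[OF N] by fastforce
qed

lemma ideal_pow_smult_Suc:
  assumes J: "ideal J R" and N: "N \<subseteq> carrier M"
  shows "ideal_pow_smult R M J (Suc n) N = ideal_smult R M J (ideal_pow_smult R M J n N)"
proof -
  \<comment> \<open>Monoid powers append the new factor on the right; commutativity of the product
    moves it to the front.\<close>
  have "J [^]\<^bsub>ideals_set R\<^esub> (Suc n) = (J [^]\<^bsub>ideals_set R\<^esub> n) \<cdot>\<^bsub>R\<^esub> J"
    by (simp add: nat_pow_def ideals_set_def)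
  then show ?thesis
    unfolding ideal_pow_smult_def
    using ideal_smult_prod[OF J ideal_pow_ideal[OF J] N] R.ideal_prod_commute[OF J ideal_pow_ideal[OF J]]
    by simp
qed

lemma ideal_pow_smult_submodule:
  "ideal J R \<Longrightarrow> N \<subseteq> carrier M \<Longrightarrow> submodule (ideal_pow_smult R M J n N) R M"
  unfolding ideal_pow_smult_def by (intro ideal_smult_submodule ideal_subset ideal_pow_ideal)

end

context module_map
begin

lemma image_ideal_smult:
  assumes J: "J \<subseteq> carrier R" and V: "V \<subseteq> carrier M"
  shows "f ` ideal_smult R M J V = ideal_smult R N J (f ` V)"
proof
  have fV: "f ` V \<subseteq> carrier N" using V closed by blast
  have "ideal_smult R M J V \<subseteq> {y \<in> carrier M. f y \<in> ideal_smult R N J (f ` V)}"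
  proof (rule dom.ideal_smult_least[OF vimage_submodule[OF cod.ideal_smult_submodule[OF J fV]]])
    fix a y assume a: "a \<in> J" and y: "y \<in> V"
    then show "a \<odot>\<^bsub>M\<^esub> y \<in> {y \<in> carrier M. f y \<in> ideal_smult R N J (f ` V)}"
      using J V cod.ideal_smult_mem[OF a, of "f y" "f ` V"] by (auto simp: linear subset_iff)
  qed
  then show "f ` ideal_smult R M J V \<subseteq> ideal_smult R N J (f ` V)" by blast
  show "ideal_smult R N J (f ` V) \<subseteq> f ` ideal_smult R M J V"
  proof (rule cod.ideal_smult_least[OF image_submodule[OF dom.ideal_smult_submodule[OF J V]]])
    fix a y assume a: "a \<in> J" and "y \<in> f ` V"
    then obtain v where v: "v \<in> V" "y = f v" by blast
    then have "a \<odot>\<^bsub>N\<^esub> y = f (a \<odot>\<^bsub>M\<^esub> v)" using a J V linear by (simp add: subset_iff)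
    then show "a \<odot>\<^bsub>N\<^esub> y \<in> f ` ideal_smult R M J V"
      using dom.ideal_smult_mem[OF a v(1)] by blast
  qed
qed

lemma image_ideal_pow_smult:
  assumes "ideal J R" "V \<subseteq> carrier M"
  shows "f ` ideal_pow_smult R M J n V = ideal_pow_smult R N J n (f ` V)"
  unfolding ideal_pow_smult_def
  using assms by (intro image_ideal_smult dom.ideal_subset dom.ideal_pow_ideal)

end

subsection \<open>Finite length and Nakayama's lemma\<close>

text \<open>A non-unit generates a proper ideal. Zorn's lemma places it in a maximal ideal, which
  can only be \<open>\<mm>\<close>.\<close>

lemma (in noetherian_local_ring) not_in_maximal_imp_unit:
  assumes a: "a \<in> carrier R" "a \<notin> \<mm>"
  shows "a \<in> Units R"
proof (rule ccontr)
  assume "a \<notin> Units R"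
  let ?S = "{J. ideal J R \<and> a \<in> J \<and> \<one> \<notin> J}"
  have "\<one> \<notin> PIdl a"
    using a(1) \<open>a \<notin> Units R\<close> m_comm by (auto simp: cgenideal_def Units_def)
  then have "?S \<noteq> {}" using cgenideal_ideal[OF a(1)] cgenideal_self[OF a(1)] by blast
  moreover have "\<Union>C \<in> ?S" if "C \<noteq> {}" "subset.chain ?S C" for C
  proof -
    have C: "C \<subseteq> ?S" using that(2) by (simp add: subset_chain_def)
    \<comment> \<open>By the ascending chain condition a nonempty chain of ideals contains its own
      union, so the union again avoids 1.\<close>
    then have "subset.chain {J. ideal J R} C" using that(2) by (auto simp: subset_chain_def)
    then show ?thesis using C ideal_chain_is_trivial[OF that(1)] by blast
  qed
  ultimately obtain J where J: "J \<in> ?S" and max: "\<And>K. K \<in> ?S \<Longrightarrow> J \<subseteq> K \<Longrightarrow> K = J"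
    using subset_Zorn_nonempty[of ?S] by blast
  have "maximalideal J R"
  proof (rule maximalidealI)
    show "ideal J R" "carrier R \<noteq> J" using J by auto
    fix K assume K: "ideal K R" "J \<subseteq> K" "K \<subseteq> carrier R"
    then show "K = J \<or> K = carrier R"
      using max[of K] J ideal.one_imp_carrier[OF K(1)] by blast
  qed
  then show False using unique_maximal[of J] J a(2) by blast
qed

lemma (in noetherian_local_ring) one_minus_maximal_unit:
  assumes a: "a \<in> \<mm>"
  shows "\<one> \<ominus> a \<in> Units R"
proof -
  interpret \<mm>: maximalideal \<mm> R by (rule maximal)
  have car: "a \<in> carrier R" using a \<mm>.Icarr by blast
  have "\<one> \<ominus> a \<notin> \<mm>"
  proof
    assume "\<one> \<ominus> a \<in> \<mm>"
    then have "(\<one> \<ominus> a) \<oplus> a \<in> \<mm>" using a by simp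
    then have "\<one> \<in> \<mm>" using car by (simp add: minus_eq a_assoc l_neg)
    then show False using \<mm>.one_imp_carrier \<mm>.I_notcarr by simp
  qed
  then show ?thesis using not_in_maximal_imp_unit car by simp
qed

context module
begin

lemma cyclic_submodule:
  assumes y: "y \<in> carrier M"
  shows "submodule ((\<lambda>r. r \<odot>\<^bsub>M\<^esub> y) ` carrier R) R M"
proof (rule submoduleI')
  show "(\<lambda>r. r \<odot>\<^bsub>M\<^esub> y) ` carrier R \<subseteq> carrier M" using y by auto
  show "\<zero>\<^bsub>M\<^esub> \<in> (\<lambda>r. r \<odot>\<^bsub>M\<^esub> y) ` carrier R" using y by (intro image_eqI[of _ _ \<zero>]) auto
  fix u assume "u \<in> (\<lambda>r. r \<odot>\<^bsub>M\<^esub> y) ` carrier R"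
  then obtain r where r: "r \<in> carrier R" "u = r \<odot>\<^bsub>M\<^esub> y" by blast
  { fix a assume "a \<in> carrier R"
    then show "a \<odot>\<^bsub>M\<^esub> u \<in> (\<lambda>r. r \<odot>\<^bsub>M\<^esub> y) ` carrier R"
      using r y by (intro image_eqI[of _ _ "a \<otimes> r"]) (auto simp: smult_assoc1) }
  fix v assume "v \<in> (\<lambda>r. r \<odot>\<^bsub>M\<^esub> y) ` carrier R"
  then obtain s where s: "s \<in> carrier R" "v = s \<odot>\<^bsub>M\<^esub> y" by blast
  show "u \<oplus>\<^bsub>M\<^esub> v \<in> (\<lambda>r. r \<odot>\<^bsub>M\<^esub> y) ` carrier R"
    using r s y by (intro image_eqI[of _ _ "r \<oplus> s"]) (auto simp: smult_l_distr)
qed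

text \<open>A proper \<open>L\<close> of least colength in \<open>A\<close> works: by additivity,
  anything strictly between \<open>L\<close> and \<open>A\<close> would have smaller
  colength.\<close>

lemma interval_length_maximal_proper:
  assumes B: "submodule B R M" and A: "submodule A R M" and "B \<subset> A"
    and fin: "interval_length R M B A \<noteq> \<infinity>"
  obtains L where "submodule L R M" "B \<subseteq> L" "L \<subset> A"
    "\<And>L'. submodule L' R M \<Longrightarrow> L \<subset> L' \<Longrightarrow> L' \<subseteq> A \<Longrightarrow> L' = A"
proof -
  let ?P = "\<lambda>L. submodule L R M \<and> B \<subseteq> L \<and> L \<subset> A"
  have "?P B" using assms by blast
  \<comment> \<open>\<open>the_enat\<close> is faithful here, since every colength considered is
    bounded by the finite length from \<open>B\<close> to \<open>A\<close>.\<close>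
  then obtain L where L: "?P L"
    and least: "\<And>L'. ?P L' \<Longrightarrow> the_enat (interval_length R M L A) \<le> the_enat (interval_length R M L' A)"
    using ex_has_least_nat[of ?P B "\<lambda>L. the_enat (interval_length R M L A)"] by blast
  show ?thesis
  proof (rule that[of L])
    fix L' assume L': "submodule L' R M" "L \<subset> L'" "L' \<subseteq> A"
    show "L' = A"
    proof (rule ccontr)
      assume "L' \<noteq> A"
      then have P': "?P L'" using L L' by blast
      have "interval_length R M L A \<le> interval_length R M B A"
        using L by (intro interval_length_mono) auto
      then obtain n where n: "interval_length R M L A = enat n" using fin by (cases "interval_length R M L A") auto
      have sum: "interval_length R M L A = interval_length R M L L' + interval_length R M L' A"
        using L L' A by (intro interval_length_add) auto
      then obtain k m where km: "interval_length R M L L' = enat k" "interval_length R M L' A = enat m"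
        using n by (cases "interval_length R M L L'"; cases "interval_length R M L' A") auto
      have "1 \<le> interval_length R M L L'" using L L' by (intro interval_length_pos) auto
      then have "1 \<le> k" using km by (simp add: one_enat_def)
      moreover have "n \<le> m" using least[OF P'] n km by simp
      ultimately show False using sum n km by simp
    qed
  qed (use L in auto)
qed

text \<open>If \<open>B\<close> were proper, take a maximal proper \<open>L\<close> above it. The
  simple quotient A/L is annihilated by \<open>q\<close>, so qA + B stays inside \<open>L\<close>,
  against \<open>cover\<close>.\<close>

lemma nakayama_interval:
  assumes local: "noetherian_local_ring R \<mm>" and q: "q \<subseteq> \<mm>"
    and B: "submodule B R M" and A: "submodule A R M" and "B \<subseteq> A"
    and fin: "interval_length R M B A \<noteq> \<infinity>"
    and cover: "A \<subseteq> ideal_smult R M q A <+>\<^bsub>M\<^esub> B"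
  shows "A = B"
proof (rule ccontr)
  interpret loc: noetherian_local_ring R \<mm> by (rule local)
  interpret \<mm>: maximalideal \<mm> R by (rule loc.maximal)
  assume "A \<noteq> B"
  then have "B \<subset> A" using assms(5) by blast
  then obtain L where L: "submodule L R M" "B \<subseteq> L" "L \<subset> A"
    and max: "\<And>L'. submodule L' R M \<Longrightarrow> L \<subset> L' \<Longrightarrow> L' \<subseteq> A \<Longrightarrow> L' = A"
    using interval_length_maximal_proper[OF B A _ fin] by blast
  have "ideal_smult R M q A \<subseteq> L"
  proof (rule ideal_smult_least[OF L(1)])
    fix a y assume a: "a \<in> q" and y: "y \<in> A"
    then have a_m: "a \<in> \<mm>" and car: "a \<in> carrier R" "y \<in> carrier M"
      using q \<mm>.Icarr submoduleE(1)[OF A] by auto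
    show "a \<odot>\<^bsub>M\<^esub> y \<in> L"
    proof (rule ccontr)
      assume notin: "a \<odot>\<^bsub>M\<^esub> y \<notin> L"
      \<comment> \<open>With a y outside \<open>L\<close>, maximality forces L + ?C = A. Hence y = l
        + r a y, and inverting 1 - r a puts y, and with it a y, into \<open>L\<close>.\<close>
      let ?C = "(\<lambda>r. r \<odot>\<^bsub>M\<^esub> (a \<odot>\<^bsub>M\<^esub> y)) ` carrier R"
      have C: "submodule ?C R M" using car by (intro cyclic_submodule) simp
      have ay: "a \<odot>\<^bsub>M\<^esub> y \<in> A" using submoduleE(4)[OF A] car y by simp
      then have "?C \<subseteq> A" using submoduleE(4)[OF A] by blast
      then have "L <+>\<^bsub>M\<^esub> ?C \<subseteq> A" using L A by (intro set_add_least) auto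
      moreover have "a \<odot>\<^bsub>M\<^esub> y \<in> ?C" using car by (intro image_eqI[of _ _ \<one>]) auto
      then have "L \<subset> L <+>\<^bsub>M\<^esub> ?C"
        using notin set_add_upper1[OF submoduleE(1)[OF L(1)] C]
          set_add_upper2[OF L(1) submoduleE(1)[OF C]] by blast
      ultimately have "y \<in> L <+>\<^bsub>M\<^esub> ?C"
        using max[OF set_add_submodule[OF L(1) C]] y by blast
      then obtain l r where l: "l \<in> L" and r: "r \<in> carrier R" and eq: "y = l \<oplus>\<^bsub>M\<^esub> r \<odot>\<^bsub>M\<^esub> (a \<odot>\<^bsub>M\<^esub> y)"
        by (auto simp: mem_set_add)
      have l_car: "l \<in> carrier M" using l submoduleE(1)[OF L(1)] by blast
      have ra: "r \<otimes> a \<in> \<mm>" "r \<otimes> a \<in> carrier R" using \<mm>.I_l_closed[OF a_m r] car r by auto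
      then obtain u where u: "u \<in> carrier R" "u \<otimes> (\<one> \<ominus> r \<otimes> a) = \<one>"
        using loc.one_minus_maximal_unit by (auto simp: Units_def)
      have "(\<one> \<ominus> r \<otimes> a) \<odot>\<^bsub>M\<^esub> y = y \<ominus>\<^bsub>M\<^esub> (r \<otimes> a) \<odot>\<^bsub>M\<^esub> y"
        using ra car by (simp add: R.minus_eq M.minus_eq smult_l_distr smult_l_minus)
      also have "\<dots> = (l \<oplus>\<^bsub>M\<^esub> (r \<otimes> a) \<odot>\<^bsub>M\<^esub> y) \<ominus>\<^bsub>M\<^esub> (r \<otimes> a) \<odot>\<^bsub>M\<^esub> y"
        using eq r car by (simp add: smult_assoc1)
      also have "\<dots> = l" using l_car ra car by (simp add: M.minus_eq M.a_assoc M.r_neg)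
      finally have "u \<odot>\<^bsub>M\<^esub> l = (u \<otimes> (\<one> \<ominus> r \<otimes> a)) \<odot>\<^bsub>M\<^esub> y"
        using u(1) ra car by (simp add: smult_assoc1)
      then have "y \<in> L" using u car submoduleE(4)[OF L(1) u(1) l] by simp
      then show False using notin submoduleE(4)[OF L(1) car(1)] by blast
    qed
  qed
  then have "ideal_smult R M q A <+>\<^bsub>M\<^esub> B \<subseteq> L" using L by (intro set_add_least)
  then show False using cover L(3) by blast
qed

section \<open>Finite length under multiplication by ideals\<close>

text \<open>Multiplication by \<open>a\<close> induces a surjection from A/D onto (aA + V)/V;
  submodules of the target are pulled back to \<open>A\<close>.\<close>

lemma interval_length_scaling_le:
  assumes a: "a \<in> carrier R" and A: "submodule A R M" and V: "submodule V R M"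
    and D: "D \<subseteq> A" "\<And>y. y \<in> D \<Longrightarrow> a \<odot>\<^bsub>M\<^esub> y \<in> V"
  shows "interval_length R M V ((\<lambda>y. a \<odot>\<^bsub>M\<^esub> y) ` A <+>\<^bsub>M\<^esub> V) \<le> interval_length R M D A"
proof (rule interval_length_map[where g = "\<lambda>W. {y \<in> carrier M. a \<odot>\<^bsub>M\<^esub> y \<in> W} \<inter> A"])
  interpret a: module_map R M M "\<lambda>y. a \<odot>\<^bsub>M\<^esub> y" by (rule scaling_map[OF a])
  note A_car = submoduleE(1)[OF A]
  { fix W assume "submodule W R M" "V \<subseteq> W"
    then show "submodule ({y \<in> carrier M. a \<odot>\<^bsub>M\<^esub> y \<in> W} \<inter> A) R M \<and>
        D \<subseteq> {y \<in> carrier M. a \<odot>\<^bsub>M\<^esub> y \<in> W} \<inter> A \<and> {y \<in> carrier M. a \<odot>\<^bsub>M\<^esub> y \<in> W} \<inter> A \<subseteq> A"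
      using D A_car a.vimage_submodule inter_submodule A by auto }
  fix U W
  assume U: "submodule U R M" and W: "submodule W R M" and "V \<subseteq> U" "U \<subseteq> W"
    and WA: "W \<subseteq> (\<lambda>y. a \<odot>\<^bsub>M\<^esub> y) ` A <+>\<^bsub>M\<^esub> V"
    and le: "{y \<in> carrier M. a \<odot>\<^bsub>M\<^esub> y \<in> W} \<inter> A \<subseteq> {y \<in> carrier M. a \<odot>\<^bsub>M\<^esub> y \<in> U} \<inter> A"
  show "W \<subseteq> U"
  proof
    fix w assume w: "w \<in> W"
    then obtain y v where y: "y \<in> A" and v: "v \<in> V" and eq: "w = a \<odot>\<^bsub>M\<^esub> y \<oplus>\<^bsub>M\<^esub> v"
      using WA by (fastforce simp: mem_set_add)
    have car: "a \<odot>\<^bsub>M\<^esub> y \<in> carrier M" "v \<in> carrier M" "y \<in> carrier M"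
      using y v a A_car submoduleE(1)[OF V] by auto
    have "v \<in> W" "v \<in> U" using v \<open>V \<subseteq> U\<close> \<open>U \<subseteq> W\<close> by auto
    then have "w \<ominus>\<^bsub>M\<^esub> v \<in> W" using w submodule_minus[OF W] by blast
    moreover have "w \<ominus>\<^bsub>M\<^esub> v = a \<odot>\<^bsub>M\<^esub> y"
      using car by (simp add: eq M.minus_eq M.a_assoc M.r_neg)
    ultimately have "a \<odot>\<^bsub>M\<^esub> y \<in> U" using le y car by auto
    then show "w \<in> U" using eq \<open>v \<in> U\<close> submoduleE(5)[OF U] by simp
  qed
qed auto

text \<open>Adjoin the elements of \<open>T\<close> one at a time: each new element enlarges the
  submodule by an image of A/D, so the total is finite. \<open>T\<close> is a bare set of generators
  so that induction applies.\<close>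

lemma interval_length_finite_smult:
  assumes "finite T" "T \<subseteq> carrier R" and A: "submodule A R M" and V: "submodule V R M"
    and D: "D \<subseteq> A" "\<And>a y. a \<in> T \<Longrightarrow> y \<in> D \<Longrightarrow> a \<odot>\<^bsub>M\<^esub> y \<in> V"
    and fin: "interval_length R M D A \<noteq> \<infinity>"
  shows "interval_length R M V (ideal_smult R M T A <+>\<^bsub>M\<^esub> V) \<noteq> \<infinity>"
  using assms(1,2) D(2)
proof (induction T rule: finite_induct)
  case empty
  have "ideal_smult R M {} A \<subseteq> V" using V by (intro ideal_smult_least) auto
  then have "interval_length R M V (ideal_smult R M {} A <+>\<^bsub>M\<^esub> V) \<le> interval_length R M V V"
    using V by (intro interval_length_mono set_add_least) auto
  then show ?case by (metis enat_0_iff(1) enat.distinct(1) interval_length_self le_zero_eq zero_enat_def)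
next
  case (insert a T)
  note A_car = submoduleE(1)[OF A]
  have a: "a \<in> carrier R" and T: "T \<subseteq> carrier R" using insert.prems by auto
  interpret a: module_map R M M "\<lambda>y. a \<odot>\<^bsub>M\<^esub> y" by (rule scaling_map[OF a])
  let ?U = "ideal_smult R M T A <+>\<^bsub>M\<^esub> V"
  let ?aA = "(\<lambda>y. a \<odot>\<^bsub>M\<^esub> y) ` A"
  have TA: "submodule (ideal_smult R M T A) R M" by (rule ideal_smult_submodule[OF T A_car])
  have U: "submodule ?U R M" by (rule set_add_submodule[OF TA V])
  have aA: "submodule ?aA R M" by (rule a.image_submodule[OF A])
  have VU: "V \<subseteq> ?U" by (rule set_add_upper2[OF TA submoduleE(1)[OF V]])
  have P: "submodule (?aA <+>\<^bsub>M\<^esub> ?U) R M" by (rule set_add_submodule[OF aA U])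
  have UP: "?U \<subseteq> ?aA <+>\<^bsub>M\<^esub> ?U" by (rule set_add_upper2[OF aA submoduleE(1)[OF U]])
  have "ideal_smult R M (insert a T) A \<subseteq> ?aA <+>\<^bsub>M\<^esub> ?U"
  proof (rule ideal_smult_least[OF P])
    fix b y assume "b \<in> insert a T" and y: "y \<in> A"
    then consider "b = a" | "b \<in> T" by blast
    then show "b \<odot>\<^bsub>M\<^esub> y \<in> ?aA <+>\<^bsub>M\<^esub> ?U"
    proof cases
      case 1
      then show ?thesis using set_add_upper1[OF submoduleE(1)[OF aA] U] y by blast
    next
      case 2
      then have "b \<odot>\<^bsub>M\<^esub> y \<in> ideal_smult R M T A" using y by (rule ideal_smult_mem)
      then show ?thesis using set_add_upper1[OF submoduleE(1)[OF TA] V] UP by blast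
    qed
  qed
  then have "interval_length R M V (ideal_smult R M (insert a T) A <+>\<^bsub>M\<^esub> V)
      \<le> interval_length R M V (?aA <+>\<^bsub>M\<^esub> ?U)"
    using VU UP by (intro interval_length_mono set_add_least P) auto
  also have "\<dots> = interval_length R M V ?U + interval_length R M ?U (?aA <+>\<^bsub>M\<^esub> ?U)"
    by (rule interval_length_add[OF V U P VU UP])
  \<comment> \<open>The scaling bound is applied over \<open>?U\<close> instead of \<open>V\<close>;
    it remains available because \<open>?U\<close> contains \<open>V\<close>, hence a D.\<close>
  also have "\<dots> \<le> interval_length R M V ?U + interval_length R M D A"
    using VU insert.prems(2)[of a] by (intro add_left_mono interval_length_scaling_le a A U D(1)) blast
  finally show ?case
    by (rule enat_le_finite) (use insert.IH[OF T] insert.prems(2) fin in auto)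
qed

text \<open>The ring elements that send \<open>A\<close> into SA form an ideal containing
  \<open>S\<close>, hence containing the ideal generated by \<open>S\<close>.\<close>

lemma ideal_smult_genideal:
  assumes S: "S \<subseteq> carrier R" and A: "A \<subseteq> carrier M"
  shows "ideal_smult R M (Idl S) A = ideal_smult R M S A"
proof
  have P: "submodule (ideal_smult R M S A) R M" by (rule ideal_smult_submodule[OF S A])
  note PE = submoduleE[OF P]
  let ?J = "{a \<in> carrier R. \<forall>y\<in>A. a \<odot>\<^bsub>M\<^esub> y \<in> ideal_smult R M S A}"
  have y_car: "y \<in> carrier M" if "y \<in> A" for y using that A by blast
  have mult: "b \<otimes> a \<in> ?J" if "a \<in> ?J" "b \<in> carrier R" for a b
    using that PE(4) y_car by (auto simp: smult_assoc1)
  have "ideal ?J R"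
  proof (rule idealI[OF R.ring_axioms])
    show "subgroup ?J (add_monoid R)"
    proof (rule R.add.subgroupI)
      show "?J \<noteq> {}" using submodule_zero[OF P] y_car by (auto intro!: exI[of _ \<zero>])
      fix a assume a: "a \<in> ?J"
      then show "\<ominus> a \<in> ?J" using PE(3) y_car by (auto simp: smult_l_minus)
      fix b assume "b \<in> ?J"
      then show "a \<oplus> b \<in> ?J" using a PE(5) y_car by (auto simp: smult_l_distr)
    qed auto
    fix a b assume "a \<in> ?J" "b \<in> carrier R"
    then show "b \<otimes> a \<in> ?J" "a \<otimes> b \<in> ?J" using mult[of a b] by (simp_all add: R.m_comm)
  qed
  then have "Idl S \<subseteq> ?J"
    by (rule R.genideal_minimal) (use S ideal_smult_mem in auto)
  then show "ideal_smult R M (Idl S) A \<subseteq> ideal_smult R M S A"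
    by (intro ideal_smult_least[OF P]) auto
  show "ideal_smult R M S A \<subseteq> ideal_smult R M (Idl S) A"
    using R.genideal_self[OF S] by (rule ideal_smult_mono) auto
qed

text \<open>\<open>KA/KD\<close> is filtered by quotients of \<open>A/D\<close>, one for each generator of \<open>K\<close>.\<close>

lemma interval_length_finite_ideal_smult:
  assumes noeth: "noetherian_ring R" and K: "ideal K R"
    and D: "submodule D R M" and A: "submodule A R M" and "D \<subseteq> A"
    and fin: "interval_length R M D A \<noteq> \<infinity>"
  shows "interval_length R M (ideal_smult R M K D) (ideal_smult R M K A) \<noteq> \<infinity>"
proof -
  obtain S where S: "S \<subseteq> carrier R" "finite S" "K = Idl S"
    using noetherian_ring.finetely_gen[OF noeth K] by blast
  note K_car = ideal_subset[OF K]
  have V: "submodule (ideal_smult R M K D) R M"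
    by (intro ideal_smult_submodule K_car submoduleE(1) D)
  have "ideal_smult R M K A = ideal_smult R M S A"
    using S ideal_smult_genideal submoduleE(1)[OF A] by simp
  also have "\<dots> \<subseteq> ideal_smult R M S A <+>\<^bsub>M\<^esub> ideal_smult R M K D"
    by (intro set_add_upper1 V submoduleE(1) ideal_smult_submodule S A)
  finally have "interval_length R M (ideal_smult R M K D) (ideal_smult R M K A)
    \<le> interval_length R M (ideal_smult R M K D) (ideal_smult R M S A <+>\<^bsub>M\<^esub> ideal_smult R M K D)"
    by (intro interval_length_mono) auto
  moreover have "interval_length R M (ideal_smult R M K D)
      (ideal_smult R M S A <+>\<^bsub>M\<^esub> ideal_smult R M K D) \<noteq> \<infinity>"
    using R.genideal_self[OF S(1)] S(3)
    by (intro interval_length_finite_smult[OF S(2,1) A V assms(5) _ fin] ideal_smult_mem) auto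
  ultimately show ?thesis by (rule enat_le_finite)
qed

section \<open>Colon submodules and reduction modulo xM\<close>

lemma elt_smult_submodule: "x \<in> carrier R \<Longrightarrow> submodule (elt_smult M x) R M"
  unfolding elt_smult_def by (rule module_map.image_submodule[OF scaling_map carrier_is_submodule])

lemma colon_submodule:
  assumes "x \<in> carrier R" "submodule V R M" "submodule A R M"
  shows "submodule (colon M V A x) R M"
proof -
  have "colon M V A x = {y \<in> carrier M. x \<odot>\<^bsub>M\<^esub> y \<in> V} \<inter> A"
    using submoduleE(1)[OF assms(3)] by (auto simp: colon_def)
  then show ?thesis
    using inter_submodule[OF module_map.vimage_submodule[OF scaling_map[OF assms(1)] assms(2)] assms(3)]
    by simp
qed

text \<open>Multiplication by \<open>x\<close> identifies \<open>(A : x)/(B : x)\<close> with \<open>(A \<inter> xM)/(B \<inter> xM)\<close>.\<close>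

lemma interval_length_mod_elt:
  assumes x: "x \<in> carrier R" and B: "submodule B R M" and A: "submodule A R M" and "B \<subseteq> A"
  shows "interval_length R M B A =
    interval_length R M (B <+>\<^bsub>M\<^esub> elt_smult M x) (A <+>\<^bsub>M\<^esub> elt_smult M x)
    + interval_length R M (colon M B (carrier M) x) (colon M A (carrier M) x)"
proof -
  interpret x: module_map R M M "\<lambda>y. x \<odot>\<^bsub>M\<^esub> y" by (rule scaling_map[OF x])
  let ?N = "elt_smult M x"
  have N: "submodule ?N R M" by (rule elt_smult_submodule[OF x])
  note car = submoduleE(1)[OF A] submoduleE(1)[OF B] submoduleE(1)[OF N]
  have BN: "submodule (B <+>\<^bsub>M\<^esub> ?N) R M" and AN: "submodule (A \<inter> ?N) R M"
    using A B N set_add_submodule inter_submodule by auto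
  \<comment> \<open>This submodule separates the two contributions: above it A/mid becomes (A +
    xM)/(B + xM), below it mid/B becomes (A \<inter> xM)/(A \<inter> xM \<inter> B).\<close>
  have mid: "A \<inter> (B <+>\<^bsub>M\<^esub> ?N) = (A \<inter> ?N) <+>\<^bsub>M\<^esub> B"
    using modular_law[OF B N A assms(4)] set_add_comm[OF car(2) submoduleE(1)[OF AN]] by simp
  have "interval_length R M B A = interval_length R M B (A \<inter> (B <+>\<^bsub>M\<^esub> ?N))
      + interval_length R M (A \<inter> (B <+>\<^bsub>M\<^esub> ?N)) A"
    using A B BN N assms(4) set_add_upper1[OF car(2) N]
    by (intro interval_length_add inter_submodule) auto
  also have "interval_length R M (A \<inter> (B <+>\<^bsub>M\<^esub> ?N)) A
      = interval_length R M (B <+>\<^bsub>M\<^esub> ?N) (A <+>\<^bsub>M\<^esub> (B <+>\<^bsub>M\<^esub> ?N))"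
    by (rule interval_length_second_iso[OF A BN, symmetric])
  also have "A <+>\<^bsub>M\<^esub> (B <+>\<^bsub>M\<^esub> ?N) = A <+>\<^bsub>M\<^esub> ?N"
  proof (rule subset_antisym)
    have S: "submodule (A <+>\<^bsub>M\<^esub> ?N) R M" by (rule set_add_submodule[OF A N])
    show "A <+>\<^bsub>M\<^esub> (B <+>\<^bsub>M\<^esub> ?N) \<subseteq> A <+>\<^bsub>M\<^esub> ?N"
      using assms(4) set_add_upper1[OF car(1) N] set_add_upper2[OF A car(3)]
      by (intro set_add_least S) auto
    show "A <+>\<^bsub>M\<^esub> ?N \<subseteq> A <+>\<^bsub>M\<^esub> (B <+>\<^bsub>M\<^esub> ?N)"
      using set_add_upper2[OF B car(3)] by (intro set_add_mono) auto
  qed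
  also have "interval_length R M B (A \<inter> (B <+>\<^bsub>M\<^esub> ?N)) = interval_length R M (A \<inter> ?N \<inter> B) (A \<inter> ?N)"
    unfolding mid by (rule interval_length_second_iso[OF AN B])
  \<comment> \<open>Having cut down to xM, the interval lies in the image of multiplication by x, so
    the correspondence theorem applies to it.\<close>
  also have "\<dots> = interval_length R M {y \<in> carrier M. x \<odot>\<^bsub>M\<^esub> y \<in> A \<inter> ?N \<inter> B}
      {y \<in> carrier M. x \<odot>\<^bsub>M\<^esub> y \<in> A \<inter> ?N}"
    by (intro x.interval_length_vimage[symmetric] inter_submodule[OF AN B] AN) (auto simp: elt_smult_def)
  also have "{y \<in> carrier M. x \<odot>\<^bsub>M\<^esub> y \<in> A \<inter> ?N \<inter> B} = colon M B (carrier M) x"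
    using assms(4) by (auto simp: colon_def elt_smult_def)
  also have "{y \<in> carrier M. x \<odot>\<^bsub>M\<^esub> y \<in> A \<inter> ?N} = colon M A (carrier M) x"
    by (auto simp: colon_def elt_smult_def)
  finally show ?thesis by (simp add: add.commute)
qed

end

subsection \<open>Singh's formula\<close>

lemma (in module_map) image_hilbert_denom:
  assumes surj: "f ` carrier M = carrier N" and q: "ideal q R" and I: "ideal I R"
  shows "f ` hilbert_denom R q I M s t = hilbert_denom R q I N s t"
proof -
  have F: "ideal_pow_smult R M I n (carrier M) \<subseteq> carrier M" for n
    by (rule dom.submoduleE(1)[OF dom.ideal_pow_smult_submodule[OF I subset_refl]])
  have "ideal_pow_smult R M q n (ideal_pow_smult R M I k (carrier M)) \<subseteq> carrier M" for n k
    by (intro dom.submoduleE(1) dom.ideal_pow_smult_submodule q F)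
  then show ?thesis
    unfolding hilbert_denom_def using F surj
    by (simp add: image_set_add image_ideal_pow_smult[OF q] image_ideal_pow_smult[OF I])
qed

text \<open>Taking preimages under the coset map adds \<open>N\<close> to both ends; this brings the
  Hilbert functions of M/xM back into the lattice of M.\<close>

lemma (in module) interval_length_quotient:
  assumes N: "submodule N R M" and A: "submodule A R M" and B: "submodule B R M" and "B \<subseteq> A"
  shows "interval_length R (quotient_module M N) ((\<lambda>y. N +>\<^bsub>M\<^esub> y) ` B) ((\<lambda>y. N +>\<^bsub>M\<^esub> y) ` A)
    = interval_length R M (B <+>\<^bsub>M\<^esub> N) (A <+>\<^bsub>M\<^esub> N)"
proof -
  interpret Q: module_map R M "quotient_module M N" "\<lambda>y. N +>\<^bsub>M\<^esub> y" by (rule quotient_map[OF N])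
  show ?thesis
    using Q.interval_length_vimage[OF Q.image_submodule[OF B] Q.image_submodule[OF A]]
      assms(4) submoduleE(1)[OF A]
    by (simp add: Q.vimage_image[OF A] Q.vimage_image[OF B] quotient_map_kernel[OF N] image_mono)
qed

section \<open>The filtration by powers of I and its finiteness\<close>

text \<open>\<open>fin\<close> is the hypothesis that q is an ideal of definition on M/IM, already
  pulled back to M.\<close>

locale singh_setting = module R M for R (structure) and M (structure) +
  fixes \<mm> I q :: "'a set" and x :: 'a
  assumes local: "noetherian_local_ring R \<mm>"
    and I: "ideal I R" and q: "ideal q R" "q \<subseteq> \<mm>"
    and fin: "interval_length R M
      (ideal_smult R M q (carrier M) <+>\<^bsub>M\<^esub> ideal_smult R M I (carrier M)) (carrier M) \<noteq> \<infinity>"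
    and x: "x \<in> I"
begin

abbreviation "filt t \<equiv> ideal_pow_smult R M I t (carrier M)"
abbreviation "denom s t \<equiv> hilbert_denom R q I M s t"
abbreviation "len \<equiv> interval_length R M"
abbreviation "xM \<equiv> elt_smult M x"
abbreviation "colon_x V \<equiv> colon M V (carrier M) x"

lemma noeth: "noetherian_ring R"
  using local by (simp add: noetherian_local_ring_def)

lemma x_carrier: "x \<in> carrier R"
  using x ideal_subset[OF I] by blast

lemma filt_submodule: "submodule (filt t) R M"
  by (intro ideal_pow_smult_submodule I) simp

lemma filt_carrier: "filt t \<subseteq> carrier M"
  by (rule submoduleE(1)[OF filt_submodule])

lemma filt_0: "filt 0 = carrier M"
  by (rule ideal_pow_smult_0[OF carrier_is_submodule])

lemma filt_Suc: "filt (Suc t) = ideal_smult R M I (filt t)"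
  by (rule ideal_pow_smult_Suc[OF I subset_refl])

lemma filt_Suc_subset: "filt (Suc t) \<subseteq> filt t"
  unfolding filt_Suc by (intro ideal_smult_subset ideal_subset I filt_submodule)

lemma q_pow_submodule: "V \<subseteq> carrier M \<Longrightarrow> submodule (ideal_pow_smult R M q n V) R M"
  by (rule ideal_pow_smult_submodule[OF q(1)])

lemma denom_eq: "denom s t = ideal_pow_smult R M q (Suc s) (filt t) <+>\<^bsub>M\<^esub> filt (Suc t)"
  by (simp add: hilbert_denom_def)

lemma denom_submodule: "submodule (denom s t) R M"
  unfolding denom_eq by (intro set_add_submodule q_pow_submodule filt_submodule filt_carrier)

lemma filt_Suc_subset_denom: "filt (Suc t) \<subseteq> denom s t"
  unfolding denom_eq by (intro set_add_upper2 q_pow_submodule filt_carrier)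

lemma denom_subset_filt: "denom s t \<subseteq> filt t"
  unfolding denom_eq ideal_pow_smult_def[of R M q]
  by (intro set_add_least filt_submodule filt_Suc_subset ideal_smult_subset ideal_subset
      ideal_pow_ideal q(1))

text \<open>I distributes over the sum and passes q^(s+1). Since x lies in I, this shows that x maps
  D_t into D_(t+1), the inclusion behind the second correction term.\<close>

lemma ideal_smult_denom: "ideal_smult R M I (denom s t) = denom s (Suc t)"
proof -
  note Q = ideal_pow_ideal[OF q(1), of "Suc s"]
  have "ideal_smult R M I (denom s t) = ideal_smult R M I (ideal_pow_smult R M q (Suc s) (filt t))
      <+>\<^bsub>M\<^esub> ideal_smult R M I (filt (Suc t))"
    unfolding denom_eq
    by (intro ideal_smult_set_add ideal_subset I q_pow_submodule filt_carrier filt_submodule)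
  also have "ideal_smult R M I (ideal_pow_smult R M q (Suc s) (filt t))
      = ideal_pow_smult R M q (Suc s) (filt (Suc t))"
    unfolding ideal_pow_smult_def[of R M q] filt_Suc by (rule ideal_smult_commute[OF I Q filt_carrier])
  finally show ?thesis by (simp add: denom_eq filt_Suc[symmetric])
qed

lemma colon_x_submodule: "submodule V R M \<Longrightarrow> submodule (colon_x V) R M"
  by (rule colon_submodule[OF x_carrier _ carrier_is_submodule])

lemma colon_x_mono: "V \<subseteq> W \<Longrightarrow> colon_x V \<subseteq> colon_x W"
  by (auto simp: colon_def)

lemma filt_subset_colon: "filt t \<subseteq> colon_x (filt (Suc t))"
  using filt_carrier ideal_smult_mem[OF x] by (auto simp: colon_def filt_Suc)

lemma denom_subset_colon: "denom s t \<subseteq> colon_x (denom s (Suc t))"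
  using submoduleE(1)[OF denom_submodule] ideal_smult_mem[OF x]
  by (auto simp: colon_def ideal_smult_denom[symmetric])

text \<open>Write J_n = q^n M + IM. The quotient J_n/J_(n+1) is an image of q^n M / q^n (qM + IM),
  which is finite because M/(qM + IM) is and q^n is finitely generated.\<close>

lemma interval_length_q_pow_finite:
  "len (ideal_pow_smult R M q n (carrier M) <+>\<^bsub>M\<^esub> filt (Suc 0)) (carrier M) \<noteq> \<infinity>"
proof (induction n)
  case 0
  have "ideal_pow_smult R M q 0 (carrier M) <+>\<^bsub>M\<^esub> filt (Suc 0) = carrier M"
    by (simp add: ideal_pow_smult_0 carrier_is_submodule filt_submodule filt_carrier set_add_absorb)
  then show ?case by simp
next
  case (Suc n)
  let ?qM = "\<lambda>n. ideal_pow_smult R M q n (carrier M)"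
  let ?J = "\<lambda>n. ?qM n <+>\<^bsub>M\<^esub> filt (Suc 0)"
  let ?Q = "q [^]\<^bsub>ideals_set R\<^esub> n"
  have Q: "ideal ?Q R" by (rule ideal_pow_ideal[OF q(1)])
  have qM: "submodule (?qM n) R M" for n by (simp add: q_pow_submodule)
  have J: "submodule (?J n) R M" for n by (intro set_add_submodule qM filt_submodule)
  have qM_Suc: "?qM (Suc n) = ideal_smult R M q (?qM n)"
    by (rule ideal_pow_smult_Suc[OF q(1) subset_refl])
  then have qM_sub: "?qM (Suc n) \<subseteq> ?qM n" by (simp add: ideal_smult_subset ideal_subset q(1) qM)
  let ?D = "ideal_smult R M q (carrier M) <+>\<^bsub>M\<^esub> ideal_smult R M I (carrier M)"
  have qI: "submodule (ideal_smult R M q (carrier M)) R M" "submodule (ideal_smult R M I (carrier M)) R M"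
    by (simp_all add: ideal_smult_submodule ideal_subset q(1) I)
  have D: "submodule ?D R M" by (intro set_add_submodule qI)
  have F1: "filt (Suc 0) = ideal_smult R M I (carrier M)" by (simp add: filt_Suc filt_0)
  have QD: "ideal_smult R M ?Q ?D \<subseteq> ?qM n \<inter> ?J (Suc n)"
  proof -
    have "ideal_smult R M ?Q ?D = ideal_smult R M ?Q (ideal_smult R M q (carrier M))
        <+>\<^bsub>M\<^esub> ideal_smult R M ?Q (filt (Suc 0))"
      unfolding F1 by (intro ideal_smult_set_add ideal_subset Q qI)
    also have "ideal_smult R M ?Q (ideal_smult R M q (carrier M)) = ?qM (Suc n)"
      unfolding qM_Suc unfolding ideal_pow_smult_def by (rule ideal_smult_commute[OF Q q(1) subset_refl])
    also have "?qM (Suc n) <+>\<^bsub>M\<^esub> ideal_smult R M ?Q (filt (Suc 0)) \<subseteq> ?J (Suc n)"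
      by (intro set_add_mono subset_refl ideal_smult_subset ideal_subset Q filt_submodule)
    finally have "ideal_smult R M ?Q ?D \<subseteq> ?J (Suc n)" .
    moreover have "ideal_smult R M ?Q ?D \<subseteq> ?qM n"
      unfolding ideal_pow_smult_def by (intro ideal_smult_mono subset_refl submoduleE(1) D)
    ultimately show ?thesis by blast
  qed
  have "len (ideal_smult R M ?Q ?D) (?qM n) \<noteq> \<infinity>"
    unfolding ideal_pow_smult_def
    by (intro interval_length_finite_ideal_smult[OF noeth Q D carrier_is_submodule _ fin] submoduleE(1) D)
  \<comment> \<open>J_n lies in q^n M + J_(n+1), so the second isomorphism theorem moves the bound
    into q^n M, where \<open>QD\<close> applies.\<close>
  moreover have "len (?J (Suc n)) (?J n) \<le> len (?J (Suc n)) (?qM n <+>\<^bsub>M\<^esub> ?J (Suc n))"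
    using set_add_upper2[OF qM filt_carrier] by (intro interval_length_mono set_add_mono) auto
  moreover have "\<dots> = len (?qM n \<inter> ?J (Suc n)) (?qM n)"
    by (rule interval_length_second_iso[OF qM J])
  moreover have "\<dots> \<le> len (ideal_smult R M ?Q ?D) (?qM n)"
    using QD by (intro interval_length_mono) auto
  ultimately have "len (?J (Suc n)) (?J n) \<noteq> \<infinity>" using enat_le_finite by metis
  moreover have "len (?J (Suc n)) (carrier M) = len (?J (Suc n)) (?J n) + len (?J n) (carrier M)"
    using qM_sub by (intro interval_length_add J carrier_is_submodule submoduleE(1) set_add_mono) auto
  ultimately show ?case using Suc enat_add_finite_iff by metis
qed

text \<open>Both ends are I^t multiples: D_t = I^t (q^(s+1) M + IM) and F_t = I^t M. So the case t =
  0 spreads to all t through the finitely generated ideal I^t.\<close>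

lemma interval_length_denom_finite: "len (denom s t) (filt t) \<noteq> \<infinity>"
proof -
  let ?J = "ideal_pow_smult R M q (Suc s) (carrier M) <+>\<^bsub>M\<^esub> filt (Suc 0)"
  let ?I = "I [^]\<^bsub>ideals_set R\<^esub> t" and ?Q = "q [^]\<^bsub>ideals_set R\<^esub> Suc s"
  have It: "ideal ?I R" by (rule ideal_pow_ideal[OF I])
  have J: "submodule ?J R M" by (intro set_add_submodule filt_submodule q_pow_submodule) simp
  have "ideal_smult R M ?I ?J = ideal_smult R M ?I (ideal_pow_smult R M q (Suc s) (carrier M))
      <+>\<^bsub>M\<^esub> ideal_smult R M ?I (filt (Suc 0))"
    by (intro ideal_smult_set_add ideal_subset It q_pow_submodule filt_submodule) simp
  also have "ideal_smult R M ?I (ideal_pow_smult R M q (Suc s) (carrier M))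
      = ideal_pow_smult R M q (Suc s) (filt t)"
    unfolding ideal_pow_smult_def by (rule ideal_smult_commute[OF It ideal_pow_ideal[OF q(1)] subset_refl])
  also have "ideal_smult R M ?I (filt (Suc 0)) = filt (Suc t)"
    unfolding filt_Suc filt_0 unfolding ideal_pow_smult_def
    by (rule ideal_smult_commute[OF It I subset_refl])
  finally have "denom s t = ideal_smult R M ?I ?J" by (simp add: denom_eq)
  then show ?thesis
    using interval_length_finite_ideal_smult[OF noeth It J carrier_is_submodule submoduleE(1)[OF J]
        interval_length_q_pow_finite]
    by (simp add: ideal_pow_smult_def[of R M I t])
qed

section \<open>The recursion in t and the generalized formula\<close>

lemma H10_eq: "H10 R q I M s t = len (denom s t) (filt t)"
  unfolding H10_def by (rule quot_length_eq[OF filt_submodule denom_submodule denom_subset_filt])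

lemma xM_submodule: "submodule xM R M"
  by (rule elt_smult_submodule[OF x_carrier])

lemma H10_quotient_eq:
  "H10 R q I (quotient_module M xM) s t = len (denom s t <+>\<^bsub>M\<^esub> xM) (filt t <+>\<^bsub>M\<^esub> xM)"
proof -
  let ?Q = "quotient_module M xM"
  interpret Q: module_map R M ?Q "\<lambda>y. xM +>\<^bsub>M\<^esub> y" by (rule quotient_map[OF xM_submodule])
  have F: "ideal_pow_smult R ?Q I t (carrier ?Q) = (\<lambda>y. xM +>\<^bsub>M\<^esub> y) ` filt t"
    using Q.image_ideal_pow_smult[OF I subset_refl] by (simp add: quotient_map_image)
  have D: "hilbert_denom R q I ?Q s t = (\<lambda>y. xM +>\<^bsub>M\<^esub> y) ` denom s t"
    by (rule Q.image_hilbert_denom[OF quotient_map_image q(1) I, symmetric])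
  show ?thesis
    unfolding H10_def F D
    by (simp add: Q.cod.quot_length_eq Q.image_submodule filt_submodule denom_submodule
        image_mono[OF denom_subset_filt] interval_length_quotient xM_submodule denom_subset_filt)
qed

lemma singh_plus_eq:
  "singh_plus R q I M x s (Suc t) = len (colon_x (denom s (Suc t)) <+>\<^bsub>M\<^esub> filt t) (colon_x (filt (Suc t)))"
  unfolding singh_plus_def diff_Suc_1
  by (intro quot_length_eq set_add_submodule set_add_least colon_x_submodule filt_submodule
      denom_submodule filt_subset_colon colon_x_mono denom_subset_filt)

lemma singh_minus_eq:
  "singh_minus R q I M x s (Suc t) = len (denom s t) (colon_x (denom s (Suc t)) \<inter> filt t)"
proof -
  have "colon M (denom s (Suc t)) (filt t) x = colon_x (denom s (Suc t)) \<inter> filt t"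
    using filt_carrier by (auto simp: colon_def)
  then show ?thesis
    unfolding singh_minus_def diff_Suc_1
    by (auto intro!: quot_length_eq inter_submodule colon_x_submodule filt_submodule denom_submodule
        intro: subsetD[OF denom_subset_colon] subsetD[OF denom_subset_filt])
qed

lemma H10_mod_elt:
  "H10 R q I M s t = H10 R q I (quotient_module M xM) s t + len (colon_x (denom s t)) (colon_x (filt t))"
  unfolding H10_eq H10_quotient_eq
  by (rule interval_length_mod_elt[OF x_carrier denom_submodule filt_submodule denom_subset_filt])

lemma H10_quotient_finite: "H10 R q I (quotient_module M xM) s t \<noteq> \<infinity>"
  using H10_mod_elt[of s t] interval_length_denom_finite[of s t] enat_add_finite_iff
  by (metis H10_eq)

text \<open>As xM \<subseteq> IM \<subseteq> D_0, both colons are all of M and the kernel term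
  vanishes.\<close>

lemma H10_0: "H10 R q I M s 0 = H10 R q I (quotient_module M xM) s 0"
proof -
  have "colon_x (filt 0) \<subseteq> colon_x (denom s 0)"
    using filt_subset_colon[of 0] colon_x_mono[OF filt_Suc_subset_denom[of 0 s]]
    by (auto simp: filt_0 colon_def)
  then have "colon_x (filt 0) = colon_x (denom s 0)"
    using colon_x_mono[OF denom_subset_filt[of s 0]] by blast
  then show ?thesis using H10_mod_elt[of s 0] by simp
qed

text \<open>Reconciles the recursion, which yields a term for every \<nu> \<ge> 1, with a first sum
  that starts at 2.\<close>

lemma singh_plus_1: "singh_plus R q I M x s (Suc 0) = 0"
proof -
  have "submodule (colon_x (denom s (Suc 0))) R M" by (intro colon_x_submodule denom_submodule)
  then have "colon_x (denom s (Suc 0)) <+>\<^bsub>M\<^esub> filt 0 = carrier M"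
    unfolding filt_0 by (intro set_add_absorb carrier_is_submodule) (auto simp: colon_def)
  moreover have "colon_x (filt (Suc 0)) = carrier M"
    using filt_subset_colon[of 0] by (auto simp: filt_0 colon_def)
  ultimately show ?thesis by (simp add: singh_plus_eq)
qed

lemma H10_Suc:
  "singh_plus R q I M x s (Suc t) \<noteq> \<infinity>" (is ?plus)
  "singh_minus R q I M x s (Suc t) \<noteq> \<infinity>" (is ?minus)
  "enat_int (H10 R q I M s (Suc t)) = enat_int (H10 R q I (quotient_module M xM) s (Suc t))
    + enat_int (singh_plus R q I M x s (Suc t)) + enat_int (H10 R q I M s t)
    - enat_int (singh_minus R q I M x s (Suc t))" (is ?eq)
proof -
  let ?D = "colon_x (denom s (Suc t))"
  \<comment> \<open>The piece common to both decompositions: it is what remains of the kernel term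
    after the first correction, and of F_t/D_t after the second. Its finiteness allows it to be
    eliminated by subtraction.\<close>
  let ?L = "len (?D \<inter> filt t) (filt t)"
  have D: "submodule ?D R M" by (intro colon_x_submodule denom_submodule)
  have "len ?D (colon_x (filt (Suc t))) = len ?D (?D <+>\<^bsub>M\<^esub> filt t)
      + singh_plus R q I M x s (Suc t)"
    unfolding singh_plus_eq
    by (intro interval_length_add set_add_submodule set_add_least set_add_upper1 D submoduleE(1)
        colon_x_submodule filt_submodule filt_subset_colon colon_x_mono denom_subset_filt)
  also have "?D <+>\<^bsub>M\<^esub> filt t = filt t <+>\<^bsub>M\<^esub> ?D"
    by (intro set_add_comm submoduleE(1) D filt_submodule)
  also have "len ?D (filt t <+>\<^bsub>M\<^esub> ?D) = ?L"
    using interval_length_second_iso[OF filt_submodule D] by (simp add: Int_commute)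
  finally have 1: "H10 R q I M s (Suc t) = H10 R q I (quotient_module M xM) s (Suc t)
      + (?L + singh_plus R q I M x s (Suc t))"
    using H10_mod_elt[of s "Suc t"] by simp
  have 2: "H10 R q I M s t = singh_minus R q I M x s (Suc t) + ?L"
    unfolding H10_eq singh_minus_eq
    by (intro interval_length_add inter_submodule D filt_submodule denom_submodule Int_greatest
        denom_subset_filt denom_subset_colon Int_lower2)
  have fin: "H10 R q I M s t \<noteq> \<infinity>" "H10 R q I M s (Suc t) \<noteq> \<infinity>"
    by (simp_all add: H10_eq interval_length_denom_finite)
  from fin(1) have minus: ?minus and L: "?L \<noteq> \<infinity>" unfolding 2 enat_add_finite_iff by blast+
  from fin(2) have plus: ?plus unfolding 1 enat_add_finite_iff by blast
  show ?plus ?minus by fact+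
  have "?L + singh_plus R q I M x s (Suc t) \<noteq> \<infinity>" using L plus enat_add_finite_iff by blast
  then show ?eq
    unfolding 1 2 using enat_int_add[OF H10_quotient_finite] enat_int_add[OF L plus] enat_int_add[OF minus L]
    by simp
qed

lemma generalized_singh:
  "enat_int (H10 R q I M s t) = enat_int (H11 R q I (quotient_module M xM) s t)
    + (\<Sum>\<nu>=2..t. enat_int (singh_plus R q I M x s \<nu>))
    - (\<Sum>\<nu>=1..t. enat_int (singh_minus R q I M x s \<nu>))"
proof (induction t)
  case 0
  then show ?case by (simp add: H10_0 H11_def)
next
  case (Suc t)
  have "(\<Sum>\<nu>=2..Suc t. enat_int (singh_plus R q I M x s \<nu>))
      = (\<Sum>\<nu>=2..t. enat_int (singh_plus R q I M x s \<nu>)) + enat_int (singh_plus R q I M x s (Suc t))"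
    \<comment> \<open>For t = 0 both ranges are empty while the recursion contributes the term at 1,
      which is zero.\<close>
    by (cases "t = 0") (simp_all add: singh_plus_1 zero_enat_def)
  moreover have "enat_int (H11 R q I (quotient_module M xM) s (Suc t))
      = enat_int (H11 R q I (quotient_module M xM) s t)
        + enat_int (H10 R q I (quotient_module M xM) s (Suc t))"
    using enat_int_sum[of "{0..t}" "H10 R q I (quotient_module M xM) s"] H10_quotient_finite
    by (simp add: H11_def enat_int_add)
  ultimately show ?case using Suc H10_Suc(3)[of s t] by simp
qed

lemma H11_finite: "H11 R q I (quotient_module M xM) s t \<noteq> \<infinity>"
  unfolding H11_def using enat_int_sum[of "{0..t}"] H10_quotient_finite by blast

lemma singh_correction_finite:
  assumes "\<nu> \<ge> 1"
  shows "singh_plus R q I M x s \<nu> \<noteq> \<infinity>" "singh_minus R q I M x s \<nu> \<noteq> \<infinity>"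
  using H10_Suc(1,2)[of s "\<nu> - 1"] assms by simp_all

section \<open>Large s and the classical formula\<close>

text \<open>The submodules q^n M + IM decrease within a finite interval above IM, so two neighbours
  agree; Nakayama's lemma then identifies them with IM. Multiplying q^(s+1) M \<subseteq> IM by I^t
  keeps the threshold independent of t.\<close>

lemma denom_eventually_filt:
  assumes fin_I: "len (filt (Suc 0)) (carrier M) \<noteq> \<infinity>"
  obtains n where "\<And>s t. s \<ge> n \<Longrightarrow> denom s t = filt (Suc t)"
proof -
  let ?qM = "\<lambda>n. ideal_pow_smult R M q n (carrier M)"
  let ?J = "\<lambda>n. ?qM n <+>\<^bsub>M\<^esub> filt (Suc 0)"
  have qM: "submodule (?qM n) R M" for n by (simp add: q_pow_submodule)
  have J: "submodule (?J n) R M" for n by (intro set_add_submodule qM filt_submodule)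
  have qM_Suc: "?qM (Suc n) = ideal_smult R M q (?qM n)" for n
    by (rule ideal_pow_smult_Suc[OF q(1) subset_refl])
  have qM_sub: "?qM (Suc n) \<subseteq> ?qM n" for n
    unfolding qM_Suc by (intro ideal_smult_subset ideal_subset q(1) qM)
  have FJ: "filt (Suc 0) \<subseteq> ?J n" for n by (rule set_add_upper2[OF qM filt_carrier])
  have qJ: "?qM n \<subseteq> ?J n" for n by (rule set_add_upper1[OF submoduleE(1)[OF qM] filt_submodule])
  have "len (filt (Suc 0)) (?J n) \<le> len (filt (Suc 0)) (carrier M)" for n
    by (rule interval_length_mono[OF subset_refl submoduleE(1)[OF J]])
  then have finJ: "len (filt (Suc 0)) (?J n) \<noteq> \<infinity>" for n using fin_I enat_le_finite by metis
  \<comment> \<open>An index of least length over IM: the next step down cannot lower the length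
    further, so it is an equality.\<close>
  obtain n where least: "\<And>k. the_enat (len (filt (Suc 0)) (?J n)) \<le> the_enat (len (filt (Suc 0)) (?J k))"
    using ex_has_least_nat[of "\<lambda>_. True" _ "\<lambda>n. the_enat (len (filt (Suc 0)) (?J n))"] by blast
  have JJ: "?J (Suc n) \<subseteq> ?J n" by (intro set_add_mono qM_sub subset_refl)
  have sum: "len (filt (Suc 0)) (?J n) = len (filt (Suc 0)) (?J (Suc n)) + len (?J (Suc n)) (?J n)"
    by (intro interval_length_add J filt_submodule FJ JJ)
  have "len (?J (Suc n)) (?J n) = 0"
  proof -
    obtain a b where ab: "len (filt (Suc 0)) (?J n) = enat a" "len (filt (Suc 0)) (?J (Suc n)) = enat b"
      using finJ[of n] finJ[of "Suc n"] by auto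
    then have "a \<le> b" using least[of "Suc n"] by simp
    then show ?thesis
      using sum unfolding ab by (cases "len (?J (Suc n)) (?J n)") (auto simp: zero_enat_def)
  qed
  then have J_eq: "?J (Suc n) = ?J n" using interval_length_eq_0_D[OF _ J J JJ] by blast
  have "?J n = filt (Suc 0)"
  proof (rule nakayama_interval[OF local q(2) filt_submodule J FJ finJ])
    show "?J n \<subseteq> ideal_smult R M q (?J n) <+>\<^bsub>M\<^esub> filt (Suc 0)"
    proof -
      have "?J n = ?J (Suc n)" using J_eq by simp
      \<comment> \<open>J_(n+1) is q (q^n M) + IM, and q^n M lies in J_n; with J_n = J_(n+1) this is
        the covering that Nakayama's lemma asks for.\<close>
      also have "\<dots> \<subseteq> ideal_smult R M q (?J n) <+>\<^bsub>M\<^esub> filt (Suc 0)"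
        unfolding qM_Suc by (intro set_add_mono ideal_smult_mono qJ subset_refl)
      finally show ?thesis .
    qed
  qed
  then have qn: "?qM n \<subseteq> filt (Suc 0)" using qJ by blast
  \<comment> \<open>The exponent attached to s is s + 1 and the powers q^k M decrease in k, so s
    \<ge> n is enough.\<close>
  have qs: "?qM (Suc s) \<subseteq> filt (Suc 0)" if "s \<ge> n" for s
    using lift_Suc_antimono_le[of ?qM n "Suc s"] qM_sub that qn by auto
  show ?thesis
  proof (rule that[of n])
    fix s t :: nat assume s: "s \<ge> n"
    let ?I = "I [^]\<^bsub>ideals_set R\<^esub> t"
    have It: "ideal ?I R" by (rule ideal_pow_ideal[OF I])
    have "ideal_pow_smult R M q (Suc s) (filt t) = ideal_smult R M ?I (?qM (Suc s))"
      unfolding ideal_pow_smult_def by (rule ideal_smult_commute[OF ideal_pow_ideal[OF q(1)] It subset_refl])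
    also have "\<dots> \<subseteq> ideal_smult R M ?I (filt (Suc 0))"
      by (rule ideal_smult_mono[OF subset_refl qs[OF s]])
    also have "\<dots> = filt (Suc t)"
      unfolding filt_Suc filt_0 unfolding ideal_pow_smult_def
      by (rule ideal_smult_commute[OF It I subset_refl])
    finally have "denom s t \<subseteq> filt (Suc t)"
      unfolding denom_eq by (intro set_add_least filt_submodule) auto
    then show "denom s t = filt (Suc t)" using filt_Suc_subset_denom by blast
  qed
qed

text \<open>F_t/F_(t+1) is F_t/D_t for large s, whose finiteness is already known; add these up from
  M downwards.\<close>

lemma filt_finite:
  assumes fin_I: "len (filt (Suc 0)) (carrier M) \<noteq> \<infinity>"
  shows "len (filt t) (carrier M) \<noteq> \<infinity>"
proof (induction t)
  case 0
  then show ?case by (simp add: filt_0)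
next
  case (Suc t)
  obtain n where n: "\<And>s t. s \<ge> n \<Longrightarrow> denom s t = filt (Suc t)"
    using denom_eventually_filt[OF fin_I] by blast
  have "len (filt (Suc t)) (filt t) \<noteq> \<infinity>"
    using interval_length_denom_finite[of n t] n[of n t] by simp
  moreover have "len (filt (Suc t)) (carrier M) = len (filt (Suc t)) (filt t) + len (filt t) (carrier M)"
    by (intro interval_length_add filt_submodule carrier_is_submodule filt_Suc_subset filt_carrier)
  ultimately show ?case using Suc enat_add_finite_iff by metis
qed

lemma quot_length_filt: "quot_length R M (filt t) (filt (Suc t)) = len (filt (Suc t)) (filt t)"
  by (rule quot_length_eq[OF filt_submodule filt_submodule filt_Suc_subset])

lemma quot_length_filt_xM:
  "quot_length R M (carrier M) (filt t <+>\<^bsub>M\<^esub> xM) = len (filt t <+>\<^bsub>M\<^esub> xM) (carrier M)"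
  by (intro quot_length_eq carrier_is_submodule set_add_submodule filt_submodule xM_submodule submoduleE(1))

lemma quot_length_colon:
  "quot_length R M (colon_x (filt (Suc t))) (filt t) = len (filt t) (colon_x (filt (Suc t)))"
  by (intro quot_length_eq colon_x_submodule filt_submodule filt_subset_colon)

lemma carrier_add_xM: "carrier M <+>\<^bsub>M\<^esub> xM = carrier M"
  by (rule set_add_absorb(1)[OF carrier_is_submodule xM_submodule submoduleE(1)[OF xM_submodule]])

text \<open>Obtained directly rather than as a limit. M/F_(t+1) is cut once at F_t and once modulo
  xM, where the kernel part is M/(F_(t+1) : x). Cutting M/F_t at the same colon lets the common
  length cancel.\<close>

lemma singh_formula:
  assumes fin_I: "len (filt (Suc 0)) (carrier M) \<noteq> \<infinity>"
  shows "len (filt (Suc t)) (filt t) \<noteq> \<infinity>" (is ?A)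
    "len (filt (Suc t) <+>\<^bsub>M\<^esub> xM) (carrier M) \<noteq> \<infinity>" (is ?B)
    "len (filt t) (colon_x (filt (Suc t))) \<noteq> \<infinity>" (is ?C)
    "enat_int (len (filt (Suc t)) (filt t)) = enat_int (len (filt (Suc t) <+>\<^bsub>M\<^esub> xM) (carrier M))
      - enat_int (len (filt t) (colon_x (filt (Suc t))))" (is ?eq)
proof -
  let ?c = "colon_x (filt (Suc t))"
  have c: "submodule ?c R M" by (intro colon_x_submodule filt_submodule)
  have "colon_x (carrier M) = carrier M" using x_carrier by (auto simp: colon_def)
  then have 1: "len (filt (Suc t)) (carrier M)
      = len (filt (Suc t) <+>\<^bsub>M\<^esub> xM) (carrier M) + len ?c (carrier M)"
    using interval_length_mod_elt[OF x_carrier filt_submodule carrier_is_submodule filt_carrier, of "Suc t"]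
    by (simp add: carrier_add_xM)
  have 2: "len (filt t) (carrier M) = len (filt t) ?c + len ?c (carrier M)"
    by (intro interval_length_add filt_submodule c carrier_is_submodule filt_subset_colon submoduleE(1))
  have 3: "len (filt (Suc t)) (carrier M) = len (filt (Suc t)) (filt t) + len (filt t) (carrier M)"
    by (intro interval_length_add filt_submodule carrier_is_submodule filt_Suc_subset filt_carrier)
  note fin = filt_finite[OF fin_I]
  have A: ?A using fin[of "Suc t"] unfolding 3 enat_add_finite_iff by blast
  have B: ?B and c_fin: "len ?c (carrier M) \<noteq> \<infinity>"
    using fin[of "Suc t"] unfolding 1 enat_add_finite_iff by blast+
  have C: ?C using fin[of t] unfolding 2 enat_add_finite_iff by blast
  show ?A ?B ?C by fact+
  have "enat_int (len (filt (Suc t)) (filt t)) + enat_int (len (filt t) (carrier M))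
      = enat_int (len (filt (Suc t) <+>\<^bsub>M\<^esub> xM) (carrier M)) + enat_int (len ?c (carrier M))"
    using 1 3 enat_int_add[OF A fin[of t]] enat_int_add[OF B c_fin] by simp
  then show ?eq using 2 enat_int_add[OF C c_fin] by simp
qed

text \<open>The summands become the successive quotients of the filtration F_t + xM, and their
  lengths add up from F_0 + xM = M.\<close>

lemma H11_eq_of_denom:
  assumes "\<And>t. denom s t = filt (Suc t)"
  shows "H11 R q I (quotient_module M xM) s t = len (filt (Suc t) <+>\<^bsub>M\<^esub> xM) (carrier M)"
proof (induction t)
  case 0
  then show ?case by (simp add: H11_def H10_quotient_eq assms filt_0 carrier_add_xM)
next
  case (Suc t)
  have "H11 R q I (quotient_module M xM) s (Suc t)
      = H11 R q I (quotient_module M xM) s t + H10 R q I (quotient_module M xM) s (Suc t)"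
    by (simp add: H11_def)
  also have "\<dots> = len (filt (Suc (Suc t)) <+>\<^bsub>M\<^esub> xM) (filt (Suc t) <+>\<^bsub>M\<^esub> xM)
      + len (filt (Suc t) <+>\<^bsub>M\<^esub> xM) (carrier M)"
    by (simp add: Suc H10_quotient_eq assms add.commute)
  also have "\<dots> = len (filt (Suc (Suc t)) <+>\<^bsub>M\<^esub> xM) (carrier M)"
    by (intro interval_length_add[symmetric] set_add_submodule filt_submodule xM_submodule
        carrier_is_submodule set_add_mono filt_Suc_subset subset_refl submoduleE(1))
  finally show ?case .
qed

text \<open>The threshold precedes t, so it is uniform in t. The correction sums are not evaluated
  term by term: their difference is forced by comparing \<open>generalized_singh\<close> with
  \<open>singh_formula\<close>, whose other terms agree.\<close>

lemma eventually_singh: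
  assumes fin_I: "len (filt (Suc 0)) (carrier M) \<noteq> \<infinity>"
  shows "\<forall>\<^sub>F s in sequentially. \<forall>t.
    H10 R q I M s t = len (filt (Suc t)) (filt t)
    \<and> H11 R q I (quotient_module M xM) s t = len (filt (Suc t) <+>\<^bsub>M\<^esub> xM) (carrier M)
    \<and> (\<Sum>\<nu>=2..t. enat_int (singh_plus R q I M x s \<nu>)) - (\<Sum>\<nu>=1..t. enat_int (singh_minus R q I M x s \<nu>))
      = - enat_int (len (filt t) (colon_x (filt (Suc t))))"
proof -
  obtain n where n: "\<And>s t. s \<ge> n \<Longrightarrow> denom s t = filt (Suc t)"
    using denom_eventually_filt[OF fin_I] by blast
  show ?thesis unfolding eventually_sequentially
  proof (intro exI[of _ n] allI impI)
    fix s t assume s: "n \<le> s"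
    have 1: "H10 R q I M s t = len (filt (Suc t)) (filt t)" by (simp add: H10_eq n[OF s])
    have 2: "H11 R q I (quotient_module M xM) s t = len (filt (Suc t) <+>\<^bsub>M\<^esub> xM) (carrier M)"
      by (rule H11_eq_of_denom[OF n[OF s]])
    show "H10 R q I M s t = len (filt (Suc t)) (filt t)
      \<and> H11 R q I (quotient_module M xM) s t = len (filt (Suc t) <+>\<^bsub>M\<^esub> xM) (carrier M)
      \<and> (\<Sum>\<nu>=2..t. enat_int (singh_plus R q I M x s \<nu>)) - (\<Sum>\<nu>=1..t. enat_int (singh_minus R q I M x s \<nu>))
        = - enat_int (len (filt t) (colon_x (filt (Suc t))))"
      using generalized_singh[of s t] singh_formula(4)[OF fin_I, of t] 1 2 by simp
  qed
qed

end

section \<open>Translation to the stated form\<close>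

text \<open>The hypothesis concerns a quotient of the quotient M/IM; undoing both coset maps leaves
  M/(qM + IM).\<close>

lemma (in module) ideal_of_definition_quotient:
  assumes I: "ideal I R" and "ideal_of_definition R \<mm> q (quotient_module M (ideal_smult R M I (carrier M)))"
  shows "interval_length R M
    (ideal_smult R M q (carrier M) <+>\<^bsub>M\<^esub> ideal_smult R M I (carrier M)) (carrier M) \<noteq> \<infinity>"
proof -
  let ?IM = "ideal_smult R M I (carrier M)"
  let ?Q = "quotient_module M ?IM"
  have q: "ideal q R" and fin: "module_length R (quotient_module ?Q (ideal_smult R ?Q q (carrier ?Q))) \<noteq> \<infinity>"
    using assms(2) by (auto simp: ideal_of_definition_def)
  have IM: "submodule ?IM R M" and qM: "submodule (ideal_smult R M q (carrier M)) R M"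
    using I q by (simp_all add: ideal_smult_submodule ideal_subset)
  interpret Q: module_map R M ?Q "\<lambda>y. ?IM +>\<^bsub>M\<^esub> y" by (rule quotient_map[OF IM])
  have "ideal_smult R ?Q q (carrier ?Q) = (\<lambda>y. ?IM +>\<^bsub>M\<^esub> y) ` ideal_smult R M q (carrier M)"
    using Q.image_ideal_smult[OF ideal_subset[OF q] subset_refl] by (simp add: quotient_map_image)
  then have "module_length R (quotient_module ?Q (ideal_smult R ?Q q (carrier ?Q)))
      = interval_length R ?Q ((\<lambda>y. ?IM +>\<^bsub>M\<^esub> y) ` ideal_smult R M q (carrier M))
        ((\<lambda>y. ?IM +>\<^bsub>M\<^esub> y) ` carrier M)"
    using Q.cod.module_length_quotient[OF Q.image_submodule[OF qM]] by (simp add: quotient_map_image)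
  also have "\<dots> = interval_length R M (ideal_smult R M q (carrier M) <+>\<^bsub>M\<^esub> ?IM) (carrier M <+>\<^bsub>M\<^esub> ?IM)"
    by (rule interval_length_quotient[OF IM carrier_is_submodule qM submoduleE(1)[OF qM]])
  also have "carrier M <+>\<^bsub>M\<^esub> ?IM = carrier M"
    by (rule set_add_absorb(1)[OF carrier_is_submodule IM submoduleE(1)[OF IM]])
  finally show ?thesis using fin by simp
qed

theorem lemma2p1:
  fixes R :: "('a, 'r) ring_scheme"
    and \<mm> I q :: "'a set"
    and M :: "('a, 'b, 'm) module_scheme"
    and x :: 'a
  assumes "noetherian_local_ring R \<mm>"
    and "ideal I R"
    and "module R M"
    and "finitely_generated_module R M"
    and "ideal_of_definition R \<mm> q (quotient_module M (ideal_smult R M I (carrier M)))"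
    and "x \<in> I"
  shows
    "(\<forall>s t.
        H10 R q I M s t \<noteq> \<infinity>
      \<and> H11 R q I (quotient_module M (elt_smult M x)) s t \<noteq> \<infinity>
      \<and> (\<forall>\<nu>\<in>{2..t}. singh_plus R q I M x s \<nu> \<noteq> \<infinity>)
      \<and> (\<forall>\<nu>\<in>{1..t}. singh_minus R q I M x s \<nu> \<noteq> \<infinity>)
      \<and> enat_int (H10 R q I M s t) =
          enat_int (H11 R q I (quotient_module M (elt_smult M x)) s t)
          + (\<Sum>\<nu>=2..t. enat_int (singh_plus R q I M x s \<nu>))
          - (\<Sum>\<nu>=1..t. enat_int (singh_minus R q I M x s \<nu>)))
   \<and> (ideal_of_definition R \<mm> I M \<longrightarrow>
        (\<forall>\<^sub>F s in sequentially. \<forall>t.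
            H10 R q I M s t =
              quot_length R M (ideal_pow_smult R M I t (carrier M))
                (ideal_pow_smult R M I (t + 1) (carrier M))
          \<and> H11 R q I (quotient_module M (elt_smult M x)) s t =
              quot_length R M (carrier M)
                (ideal_pow_smult R M I (t + 1) (carrier M) <+>\<^bsub>M\<^esub> elt_smult M x)
          \<and> (\<Sum>\<nu>=2..t. enat_int (singh_plus R q I M x s \<nu>))
              - (\<Sum>\<nu>=1..t. enat_int (singh_minus R q I M x s \<nu>)) =
              - enat_int (quot_length R M
                  (colon M (ideal_pow_smult R M I (t + 1) (carrier M)) (carrier M) x)
                  (ideal_pow_smult R M I t (carrier M))))
      \<and> (\<forall>t.
            quot_length R M (ideal_pow_smult R M I t (carrier M))
              (ideal_pow_smult R M I (t + 1) (carrier M)) \<noteq> \<infinity>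
          \<and> quot_length R M (carrier M)
              (ideal_pow_smult R M I (t + 1) (carrier M) <+>\<^bsub>M\<^esub> elt_smult M x) \<noteq> \<infinity>
          \<and> quot_length R M
              (colon M (ideal_pow_smult R M I (t + 1) (carrier M)) (carrier M) x)
              (ideal_pow_smult R M I t (carrier M)) \<noteq> \<infinity>
          \<and> enat_int (quot_length R M (ideal_pow_smult R M I t (carrier M))
              (ideal_pow_smult R M I (t + 1) (carrier M))) =
            enat_int (quot_length R M (carrier M)
              (ideal_pow_smult R M I (t + 1) (carrier M) <+>\<^bsub>M\<^esub> elt_smult M x))
            - enat_int (quot_length R M
                (colon M (ideal_pow_smult R M I (t + 1) (carrier M)) (carrier M) x)
                (ideal_pow_smult R M I t (carrier M)))))"
proof -
  interpret M: module R M by (rule assms(3))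
  interpret S: singh_setting R M \<mm> I q x
  proof (intro singh_setting.intro singh_setting_axioms.intro M.module_axioms
      M.ideal_of_definition_quotient[OF assms(2,5)] assms(1,2,6))
    show "ideal q R" "q \<subseteq> \<mm>" using assms(5) by (simp_all add: ideal_of_definition_def)
  qed
  show ?thesis
  proof (intro conjI allI impI ballI)
    fix s t
    show "H10 R q I M s t \<noteq> \<infinity>" by (simp only: S.H10_eq S.interval_length_denom_finite not_False_eq_True)
    show "H11 R q I (quotient_module M (elt_smult M x)) s t \<noteq> \<infinity>" by (rule S.H11_finite)
    show "enat_int (H10 R q I M s t) = enat_int (H11 R q I (quotient_module M (elt_smult M x)) s t)
        + (\<Sum>\<nu>=2..t. enat_int (singh_plus R q I M x s \<nu>))
        - (\<Sum>\<nu>=1..t. enat_int (singh_minus R q I M x s \<nu>))"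
      by (rule S.generalized_singh)
  next
    fix s t \<nu> :: nat
    { assume "\<nu> \<in> {2..t}"
      then show "singh_plus R q I M x s \<nu> \<noteq> \<infinity>" by (intro S.singh_correction_finite) simp }
    { assume "\<nu> \<in> {1..t}"
      then show "singh_minus R q I M x s \<nu> \<noteq> \<infinity>" by (intro S.singh_correction_finite) simp }
  next
    assume "ideal_of_definition R \<mm> I M"
    \<comment> \<open>For I acting on M itself the defining quotient is M/IM, and IM is F_1.\<close>
    then have fin_I: "interval_length R M (S.filt (Suc 0)) (carrier M) \<noteq> \<infinity>"
      using M.module_length_quotient[OF S.filt_submodule[of "Suc 0"]]
      by (simp add: ideal_of_definition_def S.filt_Suc S.filt_0)
    note lengths = S.quot_length_filt S.quot_length_filt_xM S.quot_length_colon
    show "\<forall>\<^sub>F s in sequentially. \<forall>t.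
            H10 R q I M s t =
              quot_length R M (ideal_pow_smult R M I t (carrier M))
                (ideal_pow_smult R M I (t + 1) (carrier M))
          \<and> H11 R q I (quotient_module M (elt_smult M x)) s t =
              quot_length R M (carrier M)
                (ideal_pow_smult R M I (t + 1) (carrier M) <+>\<^bsub>M\<^esub> elt_smult M x)
          \<and> (\<Sum>\<nu>=2..t. enat_int (singh_plus R q I M x s \<nu>))
              - (\<Sum>\<nu>=1..t. enat_int (singh_minus R q I M x s \<nu>)) =
              - enat_int (quot_length R M
                  (colon M (ideal_pow_smult R M I (t + 1) (carrier M)) (carrier M) x)
                  (ideal_pow_smult R M I t (carrier M)))"
      unfolding Suc_eq_plus1[symmetric] lengths by (rule S.eventually_singh[OF fin_I])
    fix t
    show "quot_length R M (S.filt t) (S.filt (t + 1)) \<noteq> \<infinity>"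
      "quot_length R M (carrier M) (S.filt (t + 1) <+>\<^bsub>M\<^esub> elt_smult M x) \<noteq> \<infinity>"
      "quot_length R M (S.colon_x (S.filt (t + 1))) (S.filt t) \<noteq> \<infinity>"
      "enat_int (quot_length R M (S.filt t) (S.filt (t + 1)))
        = enat_int (quot_length R M (carrier M) (S.filt (t + 1) <+>\<^bsub>M\<^esub> elt_smult M x))
          - enat_int (quot_length R M (S.colon_x (S.filt (t + 1))) (S.filt t))"
      unfolding Suc_eq_plus1[symmetric] lengths by (rule S.singh_formula[OF fin_I])+
  qed
qed

end
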